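(* Let $\Omega$ be an associative $\mathbb{C}$-algebra of finite or countable dimension (possibly not unital). Fix $\mathbf{x}\in W(\Omega)=\bigsqcup_{m\ge1}\Omega^m$ and $s\in\mathbb{C}$, and let $i,j\ge1$ be integers. Then $$\pi_{N,N-1}(t_{ij}(\mathbf{x};N;s))=t_{ij}(\mathbf{x};N-1;s),\qquad N>\max(i,j).$$
   Context: The Lie algebra $\mathfrak{gl}(N,\Omega)=\mathrm{Mat}(N,\mathbb{C})\otimes\Omega$ carries the commutator bracket; with $E_{ij}$ the matrix units ($1\le i,j\le N$) and $E_{ij}(x):=E_{ij}\otimes x$, one has $[E_{ij}(x),E_{kl}(y)]=\delta_{kj}E_{il}(xy)-\delta_{il}E_{kj}(yx)$. The Lie algebra $\mathfrak{gl}(N,\mathbb{C})$ acts on $\mathfrak{gl}(N,\Omega)=\mathfrak{gl}(N,\mathbb{C})\otimes\Omega$ by $\mathrm{ad}\otimes\mathrm{Id}$, i.e. $[E_{ij},E_{kl}(y)]=\delta_{kj}E_{il}(y)-\delta_{il}E_{kj}(y)$ (even if $\Omega$ is not unital); this action is by derivations and extends to the universal enveloping algebra $\mathcal{U}(\mathfrak{gl}(N,\Omega))$ by derivations. Let $I^+(N)$ be the left ideal of $\mathcal{U}(\mathfrak{gl}(N,\Omega))$ generated by all $E_{iN}(x)$, $1\le i\le N$, $x\in\Omega$, and $I^-(N)$ the right ideal generated by all $E_{Nj}(x)$, $1\le j\le N$, $x\in\Omega$. Let $\mathcal{U}(\mathfrak{gl}(N,\Omega))^{E_{NN}}$ be the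 subalgebra of elements annihilated by $[E_{NN},-]$. Its intersections with $I^+(N)$ and $I^-(N)$ coincide; the common intersection $L(N)$ is a two-sided ideal in it, and $\mathcal{U}(\mathfrak{gl}(N,\Omega))^{E_{NN}}=\mathcal{U}(\mathfrak{gl}(N-1,\Omega))\oplus L(N)$. Here $\pi_{N,N-1}\colon\mathcal{U}(\mathfrak{gl}(N,\Omega))^{E_{NN}}\to\mathcal{U}(\mathfrak{gl}(N-1,\Omega))$ is the projection along $L(N)$. For $\mathbf{x}\in\Omega^m\subset W(\Omega)$ put $\ell(\mathbf{x}):=m$. For $\mathbf{x}=(x_1,\dots,x_m)$ and $N\ge\max(i,j)$ put $e_{ij}(\mathbf{x};N):=\sum_{a_1,\dots,a_{m-1}=1}^N E_{ia_1}(x_1)E_{a_1a_2}(x_2)\cdots E_{a_{m-1}j}(x_m)\in\mathcal{U}(\mathfrak{gl}(N,\Omega))$ (equal to $E_{ij}(x_1)$ if $m=1$). $\mathrm{Comp}(m)$ is the set of compositions $\nu=(\nu_1,\dots,\nu_n)$ of $m$ (positive integers with sum $m$). For $\mathbf{x}\in\Omega^m$ and $\nu\in\mathrm{Comp}(m)$ of length $n$, $\mathbf{x}\rhd\nu:=(y_1,\dots,y_n)\in\Omega^n$, where $y_1=x_1\cdots x_{\nu_1}$, $y_2=x_{\nu_1+1}\cdots x_{\nu_1+\nu_2}$, ..., $y_n=x_{\nu_1+\dots+\nu_{n-1}+1}\cdots x_m$ (products in $\Omega$). For $s\in\mathbb{C}$ and $\mathbf{x}\in\Omega^m$, $$t_{ij}(\mathbf{x};N;s):=\sum_{\nu\in\mathrm{Comp}(m)}(-N-s)^{\ell(\mathbf{x})-\ell(\mathbf{x}\rhd\nu)}e_{ij}(\mathbf{x}\rhd\nu;N),\qquad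 0^0:=1.$$ *)

theory Defs
  imports Complex_Main "HOL-Library.Countable_Set" "HOL-Library.Poly_Mapping" "HOL-Algebra.QuotRing"
begin

section \<open>Complex associative algebras, possibly without unit\<close>

class complex_assoc_algebra = Rings.ring +
  fixes scaleC :: "complex \<Rightarrow> 'a \<Rightarrow> 'a" (infixr "*\<^sub>C" 75)
  assumes scaleC_add_right: "c *\<^sub>C (x + y) = c *\<^sub>C x + c *\<^sub>C y"
    and scaleC_add_left: "(c + d) *\<^sub>C x = c *\<^sub>C x + d *\<^sub>C x"
    and scaleC_scaleC: "c *\<^sub>C (d *\<^sub>C x) = (c * d) *\<^sub>C x"
    and scaleC_one: "1 *\<^sub>C x = x"
    and scaleC_mult_left: "(c *\<^sub>C x) * y = c *\<^sub>C (x * y)"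
    and scaleC_mult_right: "x * (c *\<^sub>C y) = c *\<^sub>C (x * y)"

global_interpretation complex_space:
  Vector_Spaces.vector_space "scaleC :: complex \<Rightarrow> 'a \<Rightarrow> 'a::complex_assoc_algebra"
  by unfold_locales (simp_all add: scaleC_add_right scaleC_add_left scaleC_scaleC scaleC_one)

definition countable_dimension :: "'a::complex_assoc_algebra itself \<Rightarrow> bool" where
  "countable_dimension _ \<longleftrightarrow>
     (\<exists>B :: 'a set. countable B \<and> complex_space.independent B \<and> complex_space.span B = UNIV)"


section \<open>The free unital complex algebra on a set\<close>

datatype 'g word = Word (letters: "'g list")

instantiation word :: (type) monoid_add
begin
definition zero_word_def: "0 = Word []"
definition plus_word_def: "v + w = Word (letters v @ letters w)"
instance
  by standard (simp_all add: zero_word_def plus_word_def)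
end

text \<open>
  Finitely supported functions on words; the convolution product of \<open>Poly_Mapping\<close> is
  bilinear concatenation of words.
\<close>
type_synonym 'g free_algebra = "'g word \<Rightarrow>\<^sub>0 complex"

definition free_algebra :: "'g set \<Rightarrow> 'g free_algebra ring" where
  "free_algebra S =
     \<lparr>carrier = {p. \<forall>w \<in> Poly_Mapping.keys p. set (letters w) \<subseteq> S},
      mult = (*), one = 1, zero = 0, add = (+)\<rparr>"

definition gen :: "'g \<Rightarrow> 'g free_algebra" where
  "gen a = Poly_Mapping.single (Word [a]) 1"

definition const :: "complex \<Rightarrow> 'g free_algebra" where
  "const c = Poly_Mapping.single 0 c"

text \<open>The derivation of the free algebra that extends a map \<open>\<phi>\<close> on the letters.\<close>
definition free_derivation :: "('g \<Rightarrow> 'g) \<Rightarrow> 'g free_algebra \<Rightarrow> 'g free_algebra" where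
  "free_derivation \<phi> p =
     (\<Sum>w \<in> Poly_Mapping.keys p. \<Sum>k < length (letters w).
        Poly_Mapping.single (Word ((letters w)[k := \<phi> (letters w ! k)])) (Poly_Mapping.lookup p w))"

lemma ring_free_algebra: "Ring.ring (free_algebra S)"
proof -
  have times: "p * q \<in> carrier (free_algebra S)"
    if "p \<in> carrier (free_algebra S)" "q \<in> carrier (free_algebra S)" for p q
  proof -
    have "set (letters w) \<subseteq> S" if "w \<in> Poly_Mapping.keys (p * q)" for w
      using keys_mult[of p q] that \<open>p \<in> _\<close> \<open>q \<in> _\<close>
      by (fastforce simp: free_algebra_def plus_word_def)
    then show ?thesis by (simp add: free_algebra_def)
  qed
  have plus: "p + q \<in> carrier (free_algebra S)"
    if "p \<in> carrier (free_algebra S)" "q \<in> carrier (free_algebra S)" for p q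
    using that Poly_Mapping.keys_add[of p q] by (auto simp: free_algebra_def)
  have neg: "\<exists>q \<in> carrier (free_algebra S). p + q = 0" if "p \<in> carrier (free_algebra S)" for p
    using that by (intro bexI[of _ "- p"]) (auto simp: free_algebra_def in_keys_iff)
  have zero_one: "0 \<in> carrier (free_algebra S)" "1 \<in> carrier (free_algebra S)"
    by (simp_all add: free_algebra_def zero_word_def flip: single_one)
  have ops: "mult (free_algebra S) = (*)" "one (free_algebra S) = 1"
    "zero (free_algebra S) = 0" "add (free_algebra S) = (+)"
    by (simp_all add: free_algebra_def)
  show ?thesis
    by (intro ringI abelian_groupI monoidI; unfold ops)
      (simp_all add: times plus neg zero_one add.assoc add.commute mult.assoc
        distrib_left distrib_right)
qed


section \<open>Universal enveloping algebras\<close>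

record 'g lie_algebra =
  lcarrier :: "'g set"
  ladd :: "'g \<Rightarrow> 'g \<Rightarrow> 'g"
  lscale :: "complex \<Rightarrow> 'g \<Rightarrow> 'g"
  lbracket :: "'g \<Rightarrow> 'g \<Rightarrow> 'g"

text \<open>
  The first two families of relations make the generators linear, so that the quotient by them
  is the tensor algebra; the third imposes the bracket.
\<close>
definition uea_relations :: "'g lie_algebra \<Rightarrow> 'g free_algebra set" where
  "uea_relations L =
     {gen (ladd L a b) - gen a - gen b | a b. a \<in> lcarrier L \<and> b \<in> lcarrier L}
   \<union> {gen (lscale L c a) - const c * gen a | c a. a \<in> lcarrier L}
   \<union> {gen a * gen b - gen b * gen a - gen (lbracket L a b) | a b. a \<in> lcarrier L \<and> b \<in> lcarrier L}"

definition uea_ideal :: "'g lie_algebra \<Rightarrow> 'g free_algebra set" where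
  "uea_ideal L = genideal (free_algebra (lcarrier L)) (uea_relations L)"

definition uea :: "'g lie_algebra \<Rightarrow> 'g free_algebra set ring" where
  "uea L = free_algebra (lcarrier L) Quot uea_ideal L"

definition uea_class :: "'g lie_algebra \<Rightarrow> 'g free_algebra \<Rightarrow> 'g free_algebra set" where
  "uea_class L p = uea_ideal L +>\<^bsub>free_algebra (lcarrier L)\<^esub> p"

definition uea_gen :: "'g lie_algebra \<Rightarrow> 'g \<Rightarrow> 'g free_algebra set" where
  "uea_gen L a = uea_class L (gen a)"

definition uea_const :: "'g lie_algebra \<Rightarrow> complex \<Rightarrow> 'g free_algebra set" where
  "uea_const L c = uea_class L (const c)"

text \<open>
  The next two maps are given on cosets by their effect on representatives. The union is over a
  constant family of cosets whenever the map on representatives is compatible with the ideals,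
  i.e. if \<open>\<phi>\<close> is a derivation of \<open>L\<close>, respectively if \<open>K\<close> is a Lie subalgebra of \<open>L\<close>.
\<close>
definition uea_derivation ::
  "'g lie_algebra \<Rightarrow> ('g \<Rightarrow> 'g) \<Rightarrow> 'g free_algebra set \<Rightarrow> 'g free_algebra set" where
  "uea_derivation L \<phi> u = (\<Union>p \<in> u. uea_class L (free_derivation \<phi> p))"

definition uea_embedding ::
  "'g lie_algebra \<Rightarrow> 'g lie_algebra \<Rightarrow> 'g free_algebra set \<Rightarrow> 'g free_algebra set" where
  "uea_embedding K L u = (\<Union>p \<in> u. uea_class L p)"


section \<open>One-sided ideals\<close>

definition left_ideal_gen :: "('a, 'b) ring_scheme \<Rightarrow> 'a set \<Rightarrow> 'a set" where
  "left_ideal_gen R S =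
     \<Inter>{I. additive_subgroup I R \<and> (\<forall>r \<in> carrier R. \<forall>a \<in> I. r \<otimes>\<^bsub>R\<^esub> a \<in> I) \<and> S \<subseteq> I}"

definition right_ideal_gen :: "('a, 'b) ring_scheme \<Rightarrow> 'a set \<Rightarrow> 'a set" where
  "right_ideal_gen R S =
     \<Inter>{I. additive_subgroup I R \<and> (\<forall>r \<in> carrier R. \<forall>a \<in> I. a \<otimes>\<^bsub>R\<^esub> r \<in> I) \<and> S \<subseteq> I}"


section \<open>Matrices over a complex algebra\<close>

text \<open>
  Matrices are indexed from 1, and \<open>N \<times> N\<close> matrices vanish outside \<open>{1..N} \<times> {1..N}\<close>; thus
  \<open>gl (N - 1)\<close> is literally a Lie subalgebra of \<open>gl N\<close>.
\<close>
type_synonym 'a matrix = "nat \<Rightarrow> nat \<Rightarrow> 'a"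

definition mat_unit :: "nat \<Rightarrow> nat \<Rightarrow> 'a::zero \<Rightarrow> 'a matrix" where
  "mat_unit i j x = (\<lambda>k l. if k = i \<and> l = j then x else 0)"

definition gl :: "nat \<Rightarrow> 'a::complex_assoc_algebra matrix lie_algebra" where
  "gl N =
     \<lparr>lcarrier = {A. \<forall>i j. A i j \<noteq> 0 \<longrightarrow> i \<in> {1..N} \<and> j \<in> {1..N}},
      ladd = (\<lambda>A B i j. A i j + B i j),
      lscale = (\<lambda>c A i j. c *\<^sub>C A i j),
      lbracket = (\<lambda>A B i j. (\<Sum>k = 1..N. A i k * B k j) - (\<Sum>k = 1..N. B i k * A k j))\<rparr>"

text \<open>The action \<open>ad \<otimes> Id\<close> of a scalar matrix.\<close>
definition gl_action ::
  "nat \<Rightarrow> complex matrix \<Rightarrow> 'a::complex_assoc_algebra matrix \<Rightarrow> 'a matrix" where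
  "gl_action N M A = (\<lambda>i j. (\<Sum>k = 1..N. M i k *\<^sub>C A k j) - (\<Sum>k = 1..N. M k j *\<^sub>C A i k))"

lemma lbracket_mat_unit:
  assumes "{i, j, k, l} \<subseteq> {1..N}"
  shows "lbracket (gl N) (mat_unit i j x) (mat_unit k l y) =
    (\<lambda>p q. (if k = j then mat_unit i l (x * y) p q else 0)
         - (if i = l then mat_unit k j (y * x) p q else 0))"
proof -
  have sum1: "(\<Sum>r = 1..N. mat_unit a b u p r * mat_unit c d v r q)
      = (if c = b then mat_unit a d (u * v) p q else 0)"
    if "b \<in> {1..N}" for a b c d p q and u v :: 'a
  proof -
    have "(\<Sum>r = 1..N. mat_unit a b u p r * mat_unit c d v r q)
        = (\<Sum>r = 1..N. if r = b then (if c = b then mat_unit a d (u * v) p q else 0) else 0)"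
      by (rule sum.cong) (auto simp: mat_unit_def)
    also have "\<dots> = (if c = b then mat_unit a d (u * v) p q else 0)"
      using that by simp
    finally show ?thesis .
  qed
  have "j \<in> {1..N}" "l \<in> {1..N}" using assms by auto
  from sum1[OF this(1)] sum1[OF this(2)] show ?thesis
    by (auto simp: gl_def fun_eq_iff)
qed

abbreviation Ugl :: "nat \<Rightarrow> 'a::complex_assoc_algebra matrix free_algebra set ring" where
  "Ugl N \<equiv> uea (gl N)"

definition E :: "nat \<Rightarrow> nat \<Rightarrow> nat \<Rightarrow> 'a::complex_assoc_algebra \<Rightarrow> 'a matrix free_algebra set" where
  "E N i j x = uea_gen (gl N) (mat_unit i j x)"

lemma ring_Ugl: "Ring.ring (Ugl N :: 'a::complex_assoc_algebra matrix free_algebra set ring)"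
proof -
  let ?L = "gl N :: 'a matrix lie_algebra"
  let ?R = "free_algebra (lcarrier ?L)"
  interpret R: Ring.ring ?R by (rule ring_free_algebra)
  have gen: "gen a \<in> carrier ?R" if "a \<in> lcarrier ?L" for a
    using that by (auto simp: free_algebra_def gen_def)
  have const: "const c \<in> carrier ?R" for c
    by (auto simp: free_algebra_def const_def zero_word_def split: if_splits)
  have mult: "p * q \<in> carrier ?R" if "p \<in> carrier ?R" "q \<in> carrier ?R" for p q
    using R.m_closed[OF that] by (simp add: free_algebra_def)
  have diff: "p - q \<in> carrier ?R" if "p \<in> carrier ?R" "q \<in> carrier ?R" for p q
    using that Poly_Mapping.keys_diff[of p q] by (auto simp: free_algebra_def)
  have carrier_iff: "a \<in> lcarrier ?L \<longleftrightarrow> (\<forall>i j. \<not> (i \<in> {1..N} \<and> j \<in> {1..N}) \<longrightarrow> a i j = 0)" for a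
    unfolding gl_def by (simp, blast)
  have ladd: "ladd ?L a b \<in> lcarrier ?L" if "a \<in> lcarrier ?L" "b \<in> lcarrier ?L" for a b
    using that unfolding carrier_iff by (simp add: gl_def)
  have lscale: "lscale ?L c a \<in> lcarrier ?L" if "a \<in> lcarrier ?L" for a c
    using that unfolding carrier_iff by (simp add: gl_def)
  have lbracket: "lbracket ?L a b \<in> lcarrier ?L" if "a \<in> lcarrier ?L" "b \<in> lcarrier ?L" for a b
  proof -
    have "lbracket ?L a b i j = 0" if "\<not> (i \<in> {1..N} \<and> j \<in> {1..N})" for i j
    proof -
      have zero: "(\<Sum>k = 1..N. c i k * d k j) = 0"
        if "c \<in> lcarrier ?L" "d \<in> lcarrier ?L" for c d
      proof (rule sum.neutral, rule ballI)
        fix k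
        have "c i k = 0 \<or> d k j = 0"
          using that \<open>\<not> (i \<in> {1..N} \<and> j \<in> {1..N})\<close> unfolding carrier_iff by blast
        then show "c i k * d k j = 0" by auto
      qed
      show ?thesis
        using zero[OF \<open>a \<in> _\<close> \<open>b \<in> _\<close>] zero[OF \<open>b \<in> _\<close> \<open>a \<in> _\<close>] by (simp add: gl_def)
    qed
    then show ?thesis unfolding carrier_iff by blast
  qed
  have "uea_relations ?L \<subseteq> carrier ?R"
    by (auto simp: uea_relations_def intro!: diff mult gen const ladd lscale lbracket)
  then have "ideal (uea_ideal ?L) ?R"
    unfolding uea_ideal_def by (rule R.genideal_ideal)
  then show ?thesis
    unfolding uea_def by (rule ideal.quotient_is_ring)
qed


section \<open>The projection onto the enveloping algebra of \<open>gl (N - 1)\<close>\<close>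

definition invariants :: "nat \<Rightarrow> 'a::complex_assoc_algebra matrix free_algebra set set" where
  "invariants N =
     {u \<in> carrier (Ugl N). uea_derivation (gl N) (gl_action N (mat_unit N N 1)) u = \<zero>\<^bsub>Ugl N\<^esub>}"

definition I_plus :: "nat \<Rightarrow> 'a::complex_assoc_algebra matrix free_algebra set set" where
  "I_plus N = left_ideal_gen (Ugl N) {E N i N x | i x. i \<in> {1..N}}"

definition I_minus :: "nat \<Rightarrow> 'a::complex_assoc_algebra matrix free_algebra set set" where
  "I_minus N = right_ideal_gen (Ugl N) {E N N j x | j x. j \<in> {1..N}}"

text \<open>
  The intersections of the invariants with \<open>I_plus\<close> and with \<open>I_minus\<close> coincide, so each of them
  equals the following set.
\<close>
definition L_ideal :: "nat \<Rightarrow> 'a::complex_assoc_algebra matrix free_algebra set set" where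
  "L_ideal N = invariants N \<inter> I_plus N \<inter> I_minus N"

definition gl_embedding ::
  "nat \<Rightarrow> 'a::complex_assoc_algebra matrix free_algebra set \<Rightarrow> 'a matrix free_algebra set" where
  "gl_embedding N = uea_embedding (gl (N - 1)) (gl N)"

text \<open>
  The component in \<open>Ugl (N - 1)\<close> with respect to the decomposition of the invariants as the
  direct sum of \<open>Ugl (N - 1)\<close> and \<open>L_ideal N\<close>.
\<close>
definition projection ::
  "nat \<Rightarrow> 'a::complex_assoc_algebra matrix free_algebra set \<Rightarrow> 'a matrix free_algebra set" where
  "projection N =
     (\<lambda>u \<in> invariants N. THE v. v \<in> carrier (Ugl (N - 1)) \<and>
        u \<ominus>\<^bsub>Ugl N\<^esub> gl_embedding N v \<in> L_ideal N)"


section \<open>The elements \<open>e\<close> and \<open>t\<close>\<close>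

definition e_elem ::
  "nat \<Rightarrow> nat \<Rightarrow> 'a::complex_assoc_algebra list \<Rightarrow> nat \<Rightarrow> 'a matrix free_algebra set" where
  "e_elem i j xs N =
     (\<Oplus>\<^bsub>Ugl N\<^esub> as \<in> {as. length as = length xs - 1 \<and> set as \<subseteq> {1..N}}.
        (let path = i # as @ [j] in
         foldr (\<lambda>k u. E N (path ! k) (path ! Suc k) (xs ! k) \<otimes>\<^bsub>Ugl N\<^esub> u)
           [0..<length xs] \<one>\<^bsub>Ugl N\<^esub>))"

definition compositions :: "nat \<Rightarrow> nat list set" where
  "compositions m = {\<nu>. (\<forall>n \<in> set \<nu>. n \<ge> 1) \<and> sum_list \<nu> = m}"

text \<open>The value on the empty list is irrelevant: only products of nonempty blocks occur.\<close>
fun block_prod :: "'a::complex_assoc_algebra list \<Rightarrow> 'a" where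
  "block_prod [] = 0"
| "block_prod [x] = x"
| "block_prod (x # y # ys) = x * block_prod (y # ys)"

fun merge :: "'a::complex_assoc_algebra list \<Rightarrow> nat list \<Rightarrow> 'a list" (infixl "\<rhd>" 70) where
  "xs \<rhd> [] = []"
| "xs \<rhd> (n # \<nu>) = block_prod (take n xs) # (drop n xs \<rhd> \<nu>)"

definition t_elem ::
  "nat \<Rightarrow> nat \<Rightarrow> 'a::complex_assoc_algebra list \<Rightarrow> nat \<Rightarrow> complex \<Rightarrow> 'a matrix free_algebra set" where
  "t_elem i j xs N s =
     (\<Oplus>\<^bsub>Ugl N\<^esub> \<nu> \<in> compositions (length xs).
        uea_const (gl N) ((- of_nat N - s) ^ (length xs - length (xs \<rhd> \<nu>)))
          \<otimes>\<^bsub>Ugl N\<^esub> e_elem i j (xs \<rhd> \<nu>) N)"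

end

theory Submission
  imports Defs "HOL-Library.Function_Algebras" "HOL-Library.Multiset"
begin

text \<open>
  Put \<open>c = - N - s\<close>. In \<open>t\<^sub>i\<^sub>j(x; N; s)\<close> every gap between two consecutive letters is either a cut, which
  creates a summation over an intermediate index up to \<open>N\<close>, or a multiplication in the coefficient
  algebra, with weight \<open>c\<close>. Hence \<open>t\<close> satisfies a recursion on its first gap (\<open>t_rep\<close>, \<open>t_elem_eq\<close>) and
  a mirrored one on its last gap (\<open>t_rep_snoc\<close>). Modulo \<open>I_plus N\<close> one has
  \<open>E\<^sub>k\<^sub>N(z) t\<^sub>N\<^sub>j(y, r) = t\<^sub>k\<^sub>j(z y, r)\<close> for \<open>j < N\<close> (\<open>gen_t_rep\<close>). So the summand \<open>a = N\<close> of a cut equals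
  the multiplied term, and lowering \<open>N\<close> by one amounts to raising the weight \<open>c\<close> by one, which is
  exactly the effect of replacing \<open>N\<close> by \<open>N - 1\<close> in \<open>- N - s\<close> (\<open>t_rep_lower\<close>). The mirrored
  computation works modulo \<open>I_minus N\<close>, and for \<open>i, j < N\<close> both elements are invariant because
  \<open>[E\<^sub>N\<^sub>N, t\<^sub>i\<^sub>j] = (\<delta>\<^sub>i\<^sub>N - \<delta>\<^sub>j\<^sub>N) t\<^sub>i\<^sub>j\<close> (\<open>free_derivation_t_rep\<close>).

  It remains to see that the component in \<open>Ugl (N - 1)\<close> is unique, that is, that an element of
  \<open>Ugl (N - 1)\<close> whose image lies in \<open>I_plus N\<close> is zero (\<open>gl_subalgebra_Int_I_plus\<close>). Adjoin a unit to
  the associative algebra of \<open>N \<times> N\<close> matrices; its \<open>m\<close>-th tensor power is a right module over the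
  enveloping algebra, each element of the Lie algebra acting as the sum over the \<open>m\<close> factors of right
  multiplication in that factor. Multilinear functionals that depend only on the first \<open>N - 1\<close> columns
  of their arguments are annihilated by \<open>E\<^sub>i\<^sub>N(x)\<close>, hence by \<open>I_plus N\<close> (\<open>act_I_plus\<close>). On the other
  hand, every element of \<open>Ugl (N - 1)\<close> is a combination of monomials in a basis, one for each multiset
  of basis elements (\<open>reducible_all\<close>). If such a combination is not zero, then one of its longest
  monomials is detected, at the tensor power of the unit, by the product of the corresponding
  coordinate functionals: shorter monomials leave a unit in some factor, and different monomials of
  the same length put different basis elements into the factors (\<open>act_word_dual\<close>).
\<close>

section \<open>The free algebra\<close>

abbreviation free_carrier :: "'g set \<Rightarrow> 'g free_algebra set" where
  "free_carrier S \<equiv> carrier (free_algebra S)"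

lemma free_algebra_ops [simp]:
  "\<zero>\<^bsub>free_algebra S\<^esub> = 0" "\<one>\<^bsub>free_algebra S\<^esub> = 1"
  "p \<oplus>\<^bsub>free_algebra S\<^esub> q = p + q" "p \<otimes>\<^bsub>free_algebra S\<^esub> q = p * q"
  by (simp_all add: free_algebra_def)

lemma free_carrier_iff:
  "p \<in> free_carrier S \<longleftrightarrow> (\<forall>w \<in> Poly_Mapping.keys p. set (letters w) \<subseteq> S)"
  by (simp add: free_algebra_def)

lemma free_carrier_zero [simp, intro]: "0 \<in> free_carrier S"
  and free_carrier_one [simp, intro]: "1 \<in> free_carrier S"
  using ring.ring_simprules(2,6)[OF ring_free_algebra[of S]] by simp_all

lemma free_carrier_add [intro]: "p \<in> free_carrier S \<Longrightarrow> q \<in> free_carrier S \<Longrightarrow> p + q \<in> free_carrier S"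
  and free_carrier_mult [intro]: "p \<in> free_carrier S \<Longrightarrow> q \<in> free_carrier S \<Longrightarrow> p * q \<in> free_carrier S"
  using ring.ring_simprules(1,5)[OF ring_free_algebra[of S]] by simp_all

lemma free_carrier_uminus [intro]: "p \<in> free_carrier S \<Longrightarrow> - p \<in> free_carrier S"
  by (simp add: free_carrier_iff in_keys_iff)

lemma free_carrier_diff [intro]: "p \<in> free_carrier S \<Longrightarrow> q \<in> free_carrier S \<Longrightarrow> p - q \<in> free_carrier S"
  using free_carrier_add[of p S "- q"] free_carrier_uminus[of q S] by simp

lemma free_carrier_sum [intro]: "(\<And>a. a \<in> A \<Longrightarrow> f a \<in> free_carrier S) \<Longrightarrow> sum f A \<in> free_carrier S"
  by (induction A rule: infinite_finite_induct) auto

lemma free_carrier_gen [intro]: "a \<in> S \<Longrightarrow> gen a \<in> free_carrier S"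
  by (auto simp: free_carrier_iff gen_def)

lemma free_carrier_const [simp, intro]: "const c \<in> free_carrier S"
  by (auto simp: free_carrier_iff const_def zero_word_def split: if_splits)

lemma free_carrier_single [intro]: "set w \<subseteq> S \<Longrightarrow> Poly_Mapping.single (Word w) c \<in> free_carrier S"
  by (auto simp: free_carrier_iff split: if_splits)

lemma free_carrier_mono: "S \<subseteq> T \<Longrightarrow> free_carrier S \<subseteq> free_carrier T"
  by (fastforce simp: free_carrier_iff)

lemma free_algebra_minus:
  assumes "p \<in> free_carrier S" shows "\<ominus>\<^bsub>free_algebra S\<^esub> p = - p"
proof -
  interpret R: Ring.ring "free_algebra S" by (rule ring_free_algebra)
  show ?thesis using assms by (intro R.minus_equality) auto
qed

lemma const_0 [simp]: "const 0 = 0" and const_1 [simp]: "const 1 = 1"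
  by (simp_all add: const_def)

lemma const_add: "const (c + d) = const c + const d"
  by (simp add: const_def single_add)

lemma const_mult: "const (c * d) = const c * const d"
  by (simp add: const_def mult_single)

lemma const_uminus: "const (- c) = - const c"
  by (simp add: const_def single_uminus)

lemma single_Nil: "Poly_Mapping.single (Word []) c = const c"
  by (simp add: const_def zero_word_def)

lemma single_Cons: "Poly_Mapping.single (Word (a # w)) (c :: complex) = gen a * Poly_Mapping.single (Word w) c"
  by (simp add: gen_def mult_single plus_word_def)

lemma single_append:
  "Poly_Mapping.single (Word (u @ w)) c = Poly_Mapping.single (Word u) 1 * Poly_Mapping.single (Word w) (c :: complex)"
  by (simp add: mult_single plus_word_def)

lemma single_const: "Poly_Mapping.single (Word w) c = const c * Poly_Mapping.single (Word w) 1"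
  by (simp add: const_def mult_single)

lemma poly_mapping_decomp: "p = (\<Sum>w \<in> Poly_Mapping.keys p. Poly_Mapping.single w (Poly_Mapping.lookup p w))"
  by (rule poly_mapping_eqI) (simp add: lookup_sum lookup_single when_def in_keys_iff)

lemma free_carrier_induct [consumes 1, case_names zero add single]:
  assumes "p \<in> free_carrier S" and "P 0"
    and "\<And>p q. p \<in> free_carrier S \<Longrightarrow> q \<in> free_carrier S \<Longrightarrow> P p \<Longrightarrow> P q \<Longrightarrow> P (p + q)"
    and "\<And>w c. set w \<subseteq> S \<Longrightarrow> P (Poly_Mapping.single (Word w) c)"
  shows "P p"
proof -
  have *: "P (sum f A) \<and> sum f A \<in> free_carrier S"
    if "finite A" "\<And>w. w \<in> A \<Longrightarrow> P (f w) \<and> f w \<in> free_carrier S" for f and A :: "'a word set"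
    using that by (induction A) (auto intro: assms(2,3))
  have "P (\<Sum>w \<in> Poly_Mapping.keys p. Poly_Mapping.single w (Poly_Mapping.lookup p w)) \<and>
      (\<Sum>w \<in> Poly_Mapping.keys p. Poly_Mapping.single w (Poly_Mapping.lookup p w)) \<in> free_carrier S"
  proof (rule *)
    fix w assume "w \<in> Poly_Mapping.keys p"
    then have "set (letters w) \<subseteq> S" using assms(1) by (simp add: free_carrier_iff)
    then show "P (Poly_Mapping.single w (Poly_Mapping.lookup p w)) \<and>
        Poly_Mapping.single w (Poly_Mapping.lookup p w) \<in> free_carrier S"
      using assms(4)[of "letters w"] free_carrier_single[of "letters w" S] by simp
  qed simp
  then show ?thesis by (simp flip: poly_mapping_decomp)
qed

lemma free_algebra_induct [case_names add single]:
  assumes "\<And>p q. P p \<Longrightarrow> P q \<Longrightarrow> P (p + q)" and "\<And>w c. P (Poly_Mapping.single (Word w) c)"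
  shows "P (p :: 'g free_algebra)"
proof -
  have "p \<in> free_carrier UNIV" by (simp add: free_carrier_iff)
  then show ?thesis
    using assms(2)[of "[]" 0] by (induction rule: free_carrier_induct) (auto intro: assms)
qed

lemma const_commute: "const c * p = p * const c"
proof (induction p rule: free_algebra_induct)
  case (single w d) then show ?case by (simp add: const_def mult_single mult.commute)
qed (simp add: algebra_simps)

lemma subgroup_free_algebraI:
  assumes "I \<subseteq> free_carrier S" "0 \<in> I" "\<And>p q. p \<in> I \<Longrightarrow> q \<in> I \<Longrightarrow> p - q \<in> I"
  shows "subgroup I (add_monoid (free_algebra S))"
proof -
  interpret R: Ring.ring "free_algebra S" by (rule ring_free_algebra)
  have neg: "- p \<in> I" if "p \<in> I" for p using assms(3)[OF assms(2) that] by simp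
  have "p + q \<in> I" if "p \<in> I" "q \<in> I" for p q
    using assms(3)[OF that(1) neg[OF that(2)]] by simp
  moreover have "inv\<^bsub>add_monoid (free_algebra S)\<^esub> p = - p" if "p \<in> I" for p
    using free_algebra_minus[of p S] that assms(1) by (auto simp: a_inv_def)
  ultimately show ?thesis
    by (intro subgroup.intro) (use assms neg in auto)
qed

section \<open>Derivations of the free algebra\<close>

lemma free_derivation_add: "free_derivation \<phi> (p + q) = free_derivation \<phi> p + free_derivation \<phi> q"
  unfolding free_derivation_def
  by (rule setsum_keys_plus_distrib) (simp_all add: single_add sum.distrib)

lemma free_derivation_single:
  "free_derivation \<phi> (Poly_Mapping.single (Word w) c) =
     (\<Sum>k < length w. Poly_Mapping.single (Word (w[k := \<phi> (w ! k)])) c)"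
  by (simp add: free_derivation_def)

lemma free_derivation_zero [simp]: "free_derivation \<phi> 0 = 0"
  by (simp add: free_derivation_def)

lemma free_derivation_const [simp]: "free_derivation \<phi> (const c) = 0"
  by (simp add: free_derivation_single flip: single_Nil)

lemma free_derivation_gen [simp]: "free_derivation \<phi> (gen a) = gen (\<phi> a)"
  by (simp add: free_derivation_single gen_def)

lemma free_derivation_uminus: "free_derivation \<phi> (- p) = - free_derivation \<phi> p"
  using free_derivation_add[of \<phi> p "- p"] by (simp add: eq_neg_iff_add_eq_0 add.commute)

lemma free_derivation_diff: "free_derivation \<phi> (p - q) = free_derivation \<phi> p - free_derivation \<phi> q"
  using free_derivation_add[of \<phi> p "- q"] by (simp add: free_derivation_uminus)

lemma free_derivation_sum: "free_derivation \<phi> (sum f A) = (\<Sum>a\<in>A. free_derivation \<phi> (f a))"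
  by (induction A rule: infinite_finite_induct) (auto simp: free_derivation_add)

lemma free_derivation_single_Cons:
  "free_derivation \<phi> (Poly_Mapping.single (Word (a # w)) c) =
     gen (\<phi> a) * Poly_Mapping.single (Word w) c + gen a * free_derivation \<phi> (Poly_Mapping.single (Word w) c)"
  by (simp only: free_derivation_single length_Cons sum.lessThan_Suc_shift)
    (simp add: single_Cons sum_distrib_left)

lemma free_derivation_const_mult: "free_derivation \<phi> (const c * p) = const c * free_derivation \<phi> p"
proof (induction p rule: free_algebra_induct)
  case (single w d)
  then show ?case
    by (simp add: const_def mult_single free_derivation_single sum_distrib_left)
qed (simp add: algebra_simps free_derivation_add)

lemma free_derivation_gen_mult:
  "free_derivation \<phi> (gen a * p) = gen (\<phi> a) * p + gen a * free_derivation \<phi> p"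
proof (induction p rule: free_algebra_induct)
  case (single w d)
  then show ?case by (simp add: free_derivation_single_Cons flip: single_Cons)
qed (simp add: algebra_simps free_derivation_add)

lemma free_derivation_mult:
  "free_derivation \<phi> (p * q) = free_derivation \<phi> p * q + p * free_derivation \<phi> q"
proof (induction p rule: free_algebra_induct)
  case (single w c)
  show ?case
  proof (induction w)
    case Nil then show ?case by (simp add: single_Nil free_derivation_const_mult)
  next
    case (Cons a w)
    then show ?case
      by (simp add: single_Cons mult.assoc free_derivation_gen_mult algebra_simps)
  qed
qed (simp add: algebra_simps free_derivation_add)

lemma free_derivation_carrier:
  assumes "p \<in> free_carrier S" "\<And>a. a \<in> S \<Longrightarrow> \<phi> a \<in> S"
  shows "free_derivation \<phi> p \<in> free_carrier S"
  using assms(1)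
proof (induction rule: free_carrier_induct)
  case (single w c)
  have "set (w[k := \<phi> (w ! k)]) \<subseteq> S" if "k < length w" for k
  proof -
    have "w ! k \<in> S" using single that nth_mem by blast
    then show ?thesis using set_update_subset_insert[of w k "\<phi> (w ! k)"] single assms(2) by blast
  qed
  then show ?case by (auto simp: free_derivation_single)
qed (auto simp: free_derivation_add)

section \<open>The defining ideal of an enveloping algebra\<close>

text \<open>
  A Lie algebra whose underlying vector space is a subspace of an ambient complex vector space.
  Neither antisymmetry nor the Jacobi identity of the bracket is needed.
\<close>
locale ambient_lie_algebra = vector_space scale
  for scale :: "complex \<Rightarrow> 'g::ab_group_add \<Rightarrow> 'g" +
  fixes L :: "'g lie_algebra"
  assumes subspace_lcarrier: "subspace (lcarrier L)"
    and ladd_eq: "ladd L = (+)"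
    and lscale_eq: "lscale L = scale"
    and lbracket_closed: "a \<in> lcarrier L \<Longrightarrow> b \<in> lcarrier L \<Longrightarrow> lbracket L a b \<in> lcarrier L"
begin

abbreviation "S \<equiv> lcarrier L"
abbreviation "J \<equiv> uea_ideal L"

lemma relations_carrier: "uea_relations L \<subseteq> free_carrier S"
  using subspace_lcarrier
  by (auto simp: uea_relations_def ladd_eq lscale_eq subspace_add subspace_scale lbracket_closed
      intro!: free_carrier_diff free_carrier_mult free_carrier_gen)

lemma ideal_J: "ideal J (free_algebra S)"
  unfolding uea_ideal_def by (rule ring.genideal_ideal[OF ring_free_algebra relations_carrier])

lemma J_carrier: "J \<subseteq> free_carrier S"
  using ideal_J by (simp add: ideal.Icarr subsetI)

lemma J_zero [simp, intro]: "0 \<in> J"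
  using additive_subgroup.zero_closed[OF ideal.axioms(1)[OF ideal_J]] by simp

lemma J_add [intro]: "p \<in> J \<Longrightarrow> q \<in> J \<Longrightarrow> p + q \<in> J"
  using additive_subgroup.a_closed[OF ideal.axioms(1)[OF ideal_J]] by simp

lemma J_lmult [intro]: "p \<in> free_carrier S \<Longrightarrow> q \<in> J \<Longrightarrow> p * q \<in> J"
  and J_rmult [intro]: "q \<in> J \<Longrightarrow> p \<in> free_carrier S \<Longrightarrow> q * p \<in> J"
  using ideal.I_l_closed[OF ideal_J] ideal.I_r_closed[OF ideal_J] by simp_all

lemma J_uminus [intro]: "p \<in> J \<Longrightarrow> - p \<in> J"
  using J_lmult[OF free_carrier_const[of "- 1"], of p] by (simp add: const_uminus)

lemma J_diff [intro]: "p \<in> J \<Longrightarrow> q \<in> J \<Longrightarrow> p - q \<in> J"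
  using J_add[of p "- q"] J_uminus[of q] by simp

lemma J_sum [intro]: "(\<And>a. a \<in> A \<Longrightarrow> f a \<in> J) \<Longrightarrow> sum f A \<in> J"
  by (induction A rule: infinite_finite_induct) auto

lemma J_rel: "uea_relations L \<subseteq> J"
  unfolding uea_ideal_def by (rule ring.genideal_self[OF ring_free_algebra relations_carrier])

lemma J_gen_add:
  assumes "a \<in> S" "b \<in> S" shows "gen (a + b) - gen a - gen b \<in> J"
proof -
  have "gen (ladd L a b) - gen a - gen b \<in> uea_relations L"
    unfolding uea_relations_def using assms by blast
  then show ?thesis using J_rel by (auto simp: ladd_eq)
qed

lemma J_gen_scale:
  assumes "a \<in> S" shows "gen (scale c a) - const c * gen a \<in> J"
proof -
  have "gen (lscale L c a) - const c * gen a \<in> uea_relations L"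
    unfolding uea_relations_def using assms by blast
  then show ?thesis using J_rel by (auto simp: lscale_eq)
qed

lemma J_gen_bracket:
  assumes "a \<in> S" "b \<in> S"
  shows "gen a * gen b - gen b * gen a - gen (lbracket L a b) \<in> J"
proof -
  have "gen a * gen b - gen b * gen a - gen (lbracket L a b) \<in> uea_relations L"
    unfolding uea_relations_def using assms by blast
  then show ?thesis using J_rel by blast
qed

lemma J_gen_zero: "gen 0 \<in> J"
  using J_gen_scale[of 0 0] subspace_lcarrier by (simp add: subspace_0)

lemma J_gen_diff: assumes "a \<in> S" "b \<in> S" shows "gen (a - b) - (gen a - gen b) \<in> J"
proof -
  have "gen (a - b + b) - gen (a - b) - gen b \<in> J"
    using assms subspace_lcarrier by (intro J_gen_add) (auto simp: subspace_diff)
  from J_uminus[OF this] show ?thesis by (simp add: algebra_simps)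
qed

text \<open>
  The set \<open>I\<close> need not consist of elements of the free algebra on the carrier; only its part there
  matters.
\<close>
lemma J_minimal:
  assumes "0 \<in> I" and "\<And>p q. p \<in> I \<Longrightarrow> q \<in> I \<Longrightarrow> p - q \<in> I"
    and "\<And>p q. p \<in> free_carrier S \<Longrightarrow> q \<in> I \<Longrightarrow> q \<in> free_carrier S \<Longrightarrow> p * q \<in> I"
    and "\<And>p q. p \<in> free_carrier S \<Longrightarrow> q \<in> I \<Longrightarrow> q \<in> free_carrier S \<Longrightarrow> q * p \<in> I"
    and "\<And>a b. a \<in> S \<Longrightarrow> b \<in> S \<Longrightarrow> gen (a + b) - gen a - gen b \<in> I"
    and "\<And>c a. a \<in> S \<Longrightarrow> gen (scale c a) - const c * gen a \<in> I"
    and "\<And>a b. a \<in> S \<Longrightarrow> b \<in> S \<Longrightarrow> gen a * gen b - gen b * gen a - gen (lbracket L a b) \<in> I"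
  shows "J \<subseteq> I"
proof -
  have "ideal (I \<inter> free_carrier S) (free_algebra S)"
    by (intro idealI ring_free_algebra subgroup_free_algebraI) (auto intro: assms)
  moreover have "uea_relations L \<subseteq> I \<inter> free_carrier S"
    using relations_carrier assms(5-7) by (auto simp: uea_relations_def ladd_eq lscale_eq)
  ultimately show ?thesis
    unfolding uea_ideal_def
    using ring.genideal_minimal[OF ring_free_algebra, of "I \<inter> free_carrier S" S "uea_relations L"] by auto
qed

lemma class_eq: "uea_class L p = {q. q - p \<in> J}"
proof -
  have "q \<in> uea_class L p \<longleftrightarrow> q - p \<in> J" for q
  proof -
    have "q \<in> uea_class L p \<longleftrightarrow> (\<exists>h \<in> J. q = h + p)"
      by (auto simp: uea_class_def a_r_coset_def')
    also have "\<dots> \<longleftrightarrow> q - p \<in> J"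
      by (metis add_diff_cancel_right' diff_add_cancel)
    finally show ?thesis .
  qed
  then show ?thesis by blast
qed

lemma class_eq_iff: "uea_class L p = uea_class L q \<longleftrightarrow> p - q \<in> J"
proof
  assume "uea_class L p = uea_class L q"
  moreover have "p \<in> uea_class L p" by (simp add: class_eq)
  ultimately show "p - q \<in> J" by (simp add: class_eq)
next
  assume pq: "p - q \<in> J"
  have "r - p \<in> J \<longleftrightarrow> r - q \<in> J" for r
    using J_add[of "r - p" "p - q"] J_diff[of "r - q" "p - q"] pq by auto
  then show "uea_class L p = uea_class L q" by (simp add: class_eq)
qed

lemma ring_uea: "Ring.ring (uea L)"
  unfolding uea_def by (rule ideal.quotient_is_ring[OF ideal_J])

lemma class_hom: "uea_class L \<in> ring_hom (free_algebra S) (uea L)"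
proof -
  have "uea_class L = (\<lambda>p. J +>\<^bsub>free_algebra S\<^esub> p)" by (simp add: uea_class_def fun_eq_iff)
  then show ?thesis using ideal.rcos_ring_hom[OF ideal_J] by (simp add: uea_def)
qed

lemma carrier_uea: "carrier (uea L) = uea_class L ` free_carrier S"
  by (auto simp: uea_def FactRing_def A_RCOSETS_def' uea_class_def)

lemma class_closed [intro]: "p \<in> free_carrier S \<Longrightarrow> uea_class L p \<in> carrier (uea L)"
  by (simp add: carrier_uea)

lemma class_add: "p \<in> free_carrier S \<Longrightarrow> q \<in> free_carrier S \<Longrightarrow>
    uea_class L (p + q) = uea_class L p \<oplus>\<^bsub>uea L\<^esub> uea_class L q"
  using ring_hom_add[OF class_hom] by simp

lemma class_mult: "p \<in> free_carrier S \<Longrightarrow> q \<in> free_carrier S \<Longrightarrow>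
    uea_class L (p * q) = uea_class L p \<otimes>\<^bsub>uea L\<^esub> uea_class L q"
  using ring_hom_mult[OF class_hom] by simp

lemma class_one: "uea_class L 1 = \<one>\<^bsub>uea L\<^esub>"
  using ring_hom_one[OF class_hom] by simp

lemma class_zero: "uea_class L 0 = \<zero>\<^bsub>uea L\<^esub>"
  using ring_hom_zero[OF class_hom ring_free_algebra ring_uea] by simp

lemma class_diff:
  assumes "p \<in> free_carrier S" "q \<in> free_carrier S"
  shows "uea_class L p \<ominus>\<^bsub>uea L\<^esub> uea_class L q = uea_class L (p - q)"
proof -
  interpret U: Ring.ring "uea L" by (rule ring_uea)
  have "uea_class L p = uea_class L (p - q) \<oplus>\<^bsub>uea L\<^esub> uea_class L q"
    using class_add[of "p - q" q] assms by auto
  moreover have "uea_class L (p - q) \<in> carrier (uea L)" "uea_class L q \<in> carrier (uea L)"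
    using assms by auto
  ultimately show ?thesis by (simp add: a_minus_def U.add.m_assoc U.r_neg)
qed

lemma class_finsum:
  assumes "finite A" "\<And>a. a \<in> A \<Longrightarrow> f a \<in> free_carrier S"
  shows "uea_class L (sum f A) = (\<Oplus>\<^bsub>uea L\<^esub> a \<in> A. uea_class L (f a))"
proof -
  interpret U: Ring.ring "uea L" by (rule ring_uea)
  show ?thesis
    using assms
  proof (induction A)
    case empty then show ?case by (simp add: class_zero)
  next
    case (insert a A)
    have "(\<lambda>a. uea_class L (f a)) \<in> A \<rightarrow> carrier (uea L)" using insert by auto
    moreover have "sum f A \<in> free_carrier S" using insert by (intro free_carrier_sum) auto
    ultimately show ?case using insert by (simp add: class_add class_closed)
  qed
qed

text \<open>A derivation of the Lie algebra induces a derivation of the enveloping algebra.\<close>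

lemma J_derivation:
  assumes closed: "\<And>a. a \<in> S \<Longrightarrow> \<phi> a \<in> S"
    and add: "\<And>a b. a \<in> S \<Longrightarrow> b \<in> S \<Longrightarrow> \<phi> (a + b) = \<phi> a + \<phi> b"
    and scale: "\<And>c a. a \<in> S \<Longrightarrow> \<phi> (scale c a) = scale c (\<phi> a)"
    and bracket: "\<And>a b. a \<in> S \<Longrightarrow> b \<in> S \<Longrightarrow>
      \<phi> (lbracket L a b) = lbracket L (\<phi> a) b + lbracket L a (\<phi> b)"
    and "p \<in> J"
  shows "free_derivation \<phi> p \<in> J"
proof -
  let ?D = "free_derivation \<phi>"
  have D: "?D p \<in> free_carrier S" if "p \<in> free_carrier S" for p
    using that closed by (rule free_derivation_carrier)
  have "J \<subseteq> {p \<in> J. ?D p \<in> J}"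
  proof (rule J_minimal)
    fix a b assume ab: "a \<in> S" "b \<in> S"
    show "gen (a + b) - gen a - gen b \<in> {p \<in> J. ?D p \<in> J}"
      using ab by (simp add: J_gen_add free_derivation_diff add closed)
    have "(gen (\<phi> a) * gen b - gen b * gen (\<phi> a) - gen (lbracket L (\<phi> a) b)) +
       (gen a * gen (\<phi> b) - gen (\<phi> b) * gen a - gen (lbracket L a (\<phi> b))) -
       (gen (lbracket L (\<phi> a) b + lbracket L a (\<phi> b)) - gen (lbracket L (\<phi> a) b) - gen (lbracket L a (\<phi> b))) \<in> J"
      using ab by (intro J_add J_diff J_gen_bracket J_gen_add) (auto simp: closed lbracket_closed)
    also have "(gen (\<phi> a) * gen b - gen b * gen (\<phi> a) - gen (lbracket L (\<phi> a) b)) +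
       (gen a * gen (\<phi> b) - gen (\<phi> b) * gen a - gen (lbracket L a (\<phi> b))) -
       (gen (lbracket L (\<phi> a) b + lbracket L a (\<phi> b)) - gen (lbracket L (\<phi> a) b) - gen (lbracket L a (\<phi> b)))
      = ?D (gen a * gen b - gen b * gen a - gen (lbracket L a b))"
      using ab by (simp add: free_derivation_diff free_derivation_mult bracket)
    finally show "gen a * gen b - gen b * gen a - gen (lbracket L a b) \<in> {p \<in> J. ?D p \<in> J}"
      using ab by (simp add: J_gen_bracket)
  next
    fix c a assume "a \<in> S"
    then show "gen (scale c a) - const c * gen a \<in> {p \<in> J. ?D p \<in> J}"
      by (simp add: J_gen_scale free_derivation_diff free_derivation_mult scale closed)
  qed (auto simp: free_derivation_diff free_derivation_mult intro!: D)
  then show ?thesis using \<open>p \<in> J\<close> by blast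
qed

lemma uea_derivation_class:
  assumes "\<And>p. p \<in> J \<Longrightarrow> free_derivation \<phi> p \<in> J"
  shows "uea_derivation L \<phi> (uea_class L p) = uea_class L (free_derivation \<phi> p)"
proof -
  have "uea_class L (free_derivation \<phi> q) = uea_class L (free_derivation \<phi> p)" if "q \<in> uea_class L p" for q
    unfolding class_eq_iff free_derivation_diff[symmetric]
    using that by (intro assms) (simp add: class_eq)
  moreover have "p \<in> uea_class L p" by (simp add: class_eq)
  ultimately show ?thesis unfolding uea_derivation_def by blast
qed

end

section \<open>Spanning by ordered monomials\<close>

text \<open>A choice of one arrangement for every finite multiset of letters.\<close>
definition arrange :: "'g list \<Rightarrow> 'g list" where
  "arrange w = (SOME v. mset v = mset w)"

lemma mset_arrange [simp]: "mset (arrange w) = mset w"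
  unfolding arrange_def by (rule someI[of _ w]) simp

lemma arrange_cong: "mset v = mset w \<Longrightarrow> arrange v = arrange w"
  by (simp add: arrange_def)

text \<open>
  The chosen arrangements of the multisets over \<open>B\<close>. They play the role of the ordered words, but no
  order on \<open>B\<close> is needed.
\<close>
definition arranged :: "'g set \<Rightarrow> 'g word set" where
  "arranged B = {Word w | w. set w \<subseteq> B \<and> arrange w = w}"

lemma arrange_arranged: "set w \<subseteq> B \<Longrightarrow> Word (arrange w) \<in> arranged B"
  unfolding arranged_def by (auto intro!: arrange_cong dest: mset_eq_setD[OF mset_arrange, THEN equalityD1, THEN subsetD])

lemma arranged_eqI:
  "Word v \<in> arranged B \<Longrightarrow> Word w \<in> arranged B \<Longrightarrow> mset v = mset w \<Longrightarrow> v = w"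
  unfolding arranged_def using arrange_cong[of v w] by auto

text \<open>The monomial given by a list of letters.\<close>
abbreviation mon :: "'g list \<Rightarrow> 'g free_algebra" where
  "mon w \<equiv> Poly_Mapping.single (Word w) 1"

lemma mon_append: "mon (u @ v) = mon u * mon v"
  by (rule single_append)

lemma mon_Cons: "mon (a # v) = gen a * mon v"
  by (rule single_Cons)

lemma keys_const_mult: "Poly_Mapping.keys (const c * p) \<subseteq> Poly_Mapping.keys p"
  using keys_mult[of "const c" p] by (auto simp: const_def split: if_splits)

context ambient_lie_algebra
begin

text \<open>The elements congruent modulo the defining ideal to a combination of arranged words.\<close>
definition reducible :: "'g set \<Rightarrow> 'g free_algebra set" where
  "reducible B = {p. \<exists>q. Poly_Mapping.keys q \<subseteq> arranged B \<and> p - q \<in> J}"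

lemma reducible_add: "p \<in> reducible B \<Longrightarrow> q \<in> reducible B \<Longrightarrow> p + q \<in> reducible B"
proof -
  assume "p \<in> reducible B" "q \<in> reducible B"
  then obtain p' q' where *: "Poly_Mapping.keys p' \<subseteq> arranged B" "Poly_Mapping.keys q' \<subseteq> arranged B"
    "p - p' \<in> J" "q - q' \<in> J"
    unfolding reducible_def by blast
  have "p + q - (p' + q') \<in> J"
    using J_add[OF *(3,4)] by (simp add: algebra_simps)
  moreover have "Poly_Mapping.keys (p' + q') \<subseteq> arranged B"
    using *(1,2) Poly_Mapping.keys_add[of p' q'] by blast
  ultimately show ?thesis unfolding reducible_def by blast
qed

lemma reducible_const_mult: assumes "p \<in> reducible B" shows "const c * p \<in> reducible B"
proof -
  obtain p' where *: "Poly_Mapping.keys p' \<subseteq> arranged B" "p - p' \<in> J"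
    using assms unfolding reducible_def by blast
  have "const c * p - const c * p' \<in> J"
    using J_lmult[OF free_carrier_const *(2)] by (simp add: algebra_simps)
  then show ?thesis using keys_const_mult[of c p'] *(1) unfolding reducible_def by blast
qed

lemma reducible_uminus: "p \<in> reducible B \<Longrightarrow> - p \<in> reducible B"
  using reducible_const_mult[of p B "- 1"] by (simp add: const_uminus)

lemma reducible_J: "p \<in> J \<Longrightarrow> p \<in> reducible B"
  unfolding reducible_def by (auto intro!: exI[of _ 0])

lemma reducible_cong: "q \<in> reducible B \<Longrightarrow> p - q \<in> reducible B \<Longrightarrow> p \<in> reducible B"
  using reducible_add[of q B "p - q"] by simp

text \<open>
  Step of an induction on the length \<open>n\<close>: modulo words of length \<open>n - 1\<close>, neighbouring letters of
  a word of length \<open>n\<close> commute, since their commutator is a single letter.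
\<close>
context
  fixes B :: "'g set" and n :: nat
  assumes shorter: "\<And>w. set w \<subseteq> S \<Longrightarrow> length w < n \<Longrightarrow> mon w \<in> reducible B"
begin

lemma reducible_swap:
  assumes "set (u @ a # b # v) \<subseteq> S" "length (u @ a # b # v) = n"
  shows "mon (u @ a # b # v) - mon (u @ b # a # v) \<in> reducible B"
proof (rule reducible_cong)
  show "mon (u @ lbracket L a b # v) \<in> reducible B"
    using assms by (intro shorter) (auto intro: lbracket_closed)
  have "mon u * (gen a * gen b - gen b * gen a - gen (lbracket L a b)) * mon v \<in> J"
    using assms by (intro J_lmult J_rmult J_gen_bracket free_carrier_single) auto
  then show "mon (u @ a # b # v) - mon (u @ b # a # v) - mon (u @ lbracket L a b # v) \<in> reducible B"
    by (intro reducible_J) (simp add: mon_append mon_Cons algebra_simps)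
qed

lemma reducible_move:
  assumes "set (u @ x @ a # v) \<subseteq> S" "length (u @ x @ a # v) = n"
  shows "mon (u @ x @ a # v) - mon (u @ a # x @ v) \<in> reducible B"
  using assms
proof (induction x arbitrary: u)
  case Nil
  show ?case by (simp add: reducible_J)
next
  case (Cons b x)
  have "mon ((u @ [b]) @ x @ a # v) - mon ((u @ [b]) @ a # x @ v) \<in> reducible B"
    using Cons.prems by (intro Cons.IH) auto
  moreover have "mon (u @ b # a # (x @ v)) - mon (u @ a # b # (x @ v)) \<in> reducible B"
    using Cons.prems by (intro reducible_swap) auto
  ultimately show ?case
    using reducible_add by fastforce
qed

lemma reducible_permute:
  assumes "set (u @ w) \<subseteq> S" "length (u @ w) = n" "mset w = mset w'"
  shows "mon (u @ w) - mon (u @ w') \<in> reducible B"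
  using assms
proof (induction w arbitrary: u w')
  case Nil
  then show ?case by (simp add: reducible_J)
next
  case (Cons a w)
  have "a \<in> set w'" using Cons.prems(3) by (metis list.set_intros(1) mset_eq_setD)
  then obtain x v where w': "w' = x @ a # v" by (meson split_list)
  have len: "length w' = length (a # w)" and set: "set w' = set (a # w)"
    using Cons.prems(3) by (metis mset_eq_length, metis mset_eq_setD)
  have "mon ((u @ [a]) @ w) - mon ((u @ [a]) @ (x @ v)) \<in> reducible B"
    using Cons.prems w' by (intro Cons.IH) auto
  moreover have "mon (u @ x @ a # v) - mon (u @ a # x @ v) \<in> reducible B"
    using Cons.prems len set w' by (intro reducible_move) auto
  ultimately show ?case
    using reducible_add[OF _ reducible_uminus] by (fastforce simp: w')
qed

lemma reducible_basis_word:
  assumes "set w \<subseteq> B" "B \<subseteq> S" "length w = n"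
  shows "mon w \<in> reducible B"
proof (rule reducible_cong)
  show "mon (arrange w) \<in> reducible B"
    using arrange_arranged[OF assms(1)] unfolding reducible_def by (auto intro!: exI[of _ "mon (arrange w)"])
  show "mon w - mon (arrange w) \<in> reducible B"
    using reducible_permute[of "[]" w "arrange w"] assms by auto
qed

text \<open>
  The letters of \<open>v\<close> are expanded one after the other in terms of \<open>B\<close>; \<open>u\<close> collects those that are
  already elements of \<open>B\<close>.
\<close>
lemma reducible_word:
  assumes "set u \<subseteq> B" "set v \<subseteq> S" "B \<subseteq> S" "S \<subseteq> span B" "length (u @ v) = n"
  shows "mon (u @ v) \<in> reducible B"
  using assms
proof (induction v arbitrary: u)
  case Nil
  then show ?case by (simp add: reducible_basis_word)
next
  case (Cons a v)
  have u: "mon u \<in> free_carrier S" and v: "mon v \<in> free_carrier S"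
    using Cons.prems by (auto intro!: free_carrier_single)
  have J': "mon u * p * mon v \<in> J" if "p \<in> J" for p
    using u v that by blast
  have "a \<in> span B" using Cons.prems by auto
  then have "a \<in> S \<and> mon (u @ a # v) \<in> reducible B"
  proof (induction rule: span_induct_alt)
    case base
    have "mon (u @ 0 # v) \<in> J"
      using J'[OF J_gen_zero] by (simp add: mon_append mon_Cons mult.assoc)
    then show ?case using subspace_lcarrier by (simp add: reducible_J subspace_0)
  next
    case (step c b y)
    have S: "b \<in> S" "scale c b \<in> S"
      using step Cons.prems(3) subspace_lcarrier by (auto simp: subspace_scale)
    have "mon ((u @ [b]) @ v) \<in> reducible B"
      using step Cons.prems by (intro Cons.IH) auto
    then have "mon (u @ b # v) \<in> reducible B" by simp
    then have *: "const c * mon (u @ b # v) + mon (u @ y # v) \<in> reducible B"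
      using step by (intro reducible_add reducible_const_mult) auto
    have "mon u * ((gen (scale c b + y) - gen (scale c b) - gen y) + (gen (scale c b) - const c * gen b)) * mon v \<in> J"
      using S step by (intro J' J_add J_gen_add J_gen_scale) auto
    also have "mon u * ((gen (scale c b + y) - gen (scale c b) - gen y) + (gen (scale c b) - const c * gen b)) * mon v
      = mon (u @ (scale c b + y) # v) - (const c * mon (u @ b # v) + mon (u @ y # v))"
      by (simp add: mon_append mon_Cons algebra_simps)
        (metis const_commute mult.assoc)
    finally have "mon (u @ (scale c b + y) # v) \<in> reducible B"
      using * reducible_cong reducible_J by blast
    then show ?case using S step subspace_lcarrier by (simp add: subspace_add)
  qed
  then show ?case by blast
qed

end

text \<open>
  The easy half of the Poincare--Birkhoff--Witt theorem: the arranged monomials in a spanning set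
  span the enveloping algebra.
\<close>
lemma reducible_all:
  assumes "B \<subseteq> S" "S \<subseteq> span B" "p \<in> free_carrier S"
  shows "p \<in> reducible B"
proof -
  have "mon w \<in> reducible B" if "set w \<subseteq> S" for w
    using that
  proof (induction w rule: length_induct)
    case (1 w)
    then show ?case using reducible_word[of "length w" B "[]" w] assms by auto
  qed
  with assms(3) show ?thesis
  proof (induction rule: free_carrier_induct)
    case (single w c)
    then show ?case using single_const[of w c] by (simp add: reducible_const_mult)
  qed (auto intro: reducible_add reducible_J)
qed

end

section \<open>Enveloping algebras of commutator Lie algebras acting on multilinear functionals\<close>

text \<open>A Lie algebra whose bracket is the commutator of an associative product.\<close>
locale commutator_lie_algebra = ambient_lie_algebra scale L
  for scale :: "complex \<Rightarrow> 'g::ab_group_add \<Rightarrow> 'g" and L +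
  fixes pr :: "'g \<Rightarrow> 'g \<Rightarrow> 'g"
  assumes pr_add_left: "pr (a + b) d = pr a d + pr b d"
    and pr_add_right: "pr d (a + b) = pr d a + pr d b"
    and pr_scale_left: "pr (scale c a) b = scale c (pr a b)"
    and pr_scale_right: "pr a (scale c b) = scale c (pr a b)"
    and pr_assoc: "pr (pr a b) d = pr a (pr b d)"
    and lbracket_eq: "lbracket L a b = pr a b - pr b a"
begin

lemma pr_diff_right: "pr d (a - b) = pr d a - pr d b"
  using pr_add_right[of d "a - b" b] by (simp add: algebra_simps)

text \<open>
  Right multiplication on the algebra with a unit adjoined. The unit is \<open>None\<close>; sums of multiples of
  the unit and elements of the algebra are not represented, as they do not arise from the unit and
  from elements of the algebra by right multiplication.
\<close>
fun rmul :: "'g option \<Rightarrow> 'g \<Rightarrow> 'g option" where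
  "rmul None a = Some a"
| "rmul (Some x) a = Some (pr x a)"

text \<open>
  An element \<open>a\<close> acts on functionals of \<open>m\<close> arguments as the sum over the arguments of right
  multiplication by \<open>a\<close> in that argument. The arguments are \<open>f 0, \<dots>, f (m - 1)\<close>.
\<close>
definition step :: "nat \<Rightarrow> 'g \<Rightarrow> ((nat \<Rightarrow> 'g option) \<Rightarrow> complex) \<Rightarrow> (nat \<Rightarrow> 'g option) \<Rightarrow> complex" where
  "step m a F = (\<lambda>f. \<Sum>k<m. F (f(k := rmul (f k) a)))"

text \<open>
  Linearity in each argument that is an element of the algebra; no condition relates the values at
  the unit to the others.
\<close>
definition multilinear :: "nat \<Rightarrow> ((nat \<Rightarrow> 'g option) \<Rightarrow> complex) \<Rightarrow> bool" where
  "multilinear m F \<longleftrightarrow> (\<forall>k<m. \<forall>f.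
     (\<forall>a b. F (f(k := Some (a + b))) = F (f(k := Some a)) + F (f(k := Some b))) \<and>
     (\<forall>c a. F (f(k := Some (scale c a))) = c * F (f(k := Some a))))"

text \<open>
  The action of the free algebra that extends \<open>step\<close>. It is a left action on functionals, because
  the arguments are multiplied from the right.
\<close>
definition act :: "nat \<Rightarrow> 'g free_algebra \<Rightarrow> ((nat \<Rightarrow> 'g option) \<Rightarrow> complex) \<Rightarrow> (nat \<Rightarrow> 'g option) \<Rightarrow> complex" where
  "act m p F = (\<lambda>f. \<Sum>w \<in> Poly_Mapping.keys p. Poly_Mapping.lookup p w * foldr (step m) (letters w) F f)"

lemma multilinear_add:
  "multilinear m F \<Longrightarrow> k < m \<Longrightarrow> F (f(k := Some (a + b))) = F (f(k := Some a)) + F (f(k := Some b))"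
  and multilinear_scale:
  "multilinear m F \<Longrightarrow> k < m \<Longrightarrow> F (f(k := Some (scale c a))) = c * F (f(k := Some a))"
  by (auto simp: multilinear_def)

lemma multilinear_diff:
  assumes "multilinear m F" "k < m"
  shows "F (f(k := Some (a - b))) = F (f(k := Some a)) - F (f(k := Some b))"
  using multilinear_add[OF assms, of f "a - b" b] by simp

lemma step_update:
  assumes "k < m"
  shows "step m a F (f(k := Some x)) =
    F (f(k := Some (pr x a))) + (\<Sum>l \<in> {..<m} - {k}. F (f(l := rmul (f l) a, k := Some x)))"
proof -
  have "step m a F (f(k := Some x)) =
      F (f(k := Some (pr x a))) + (\<Sum>l \<in> {..<m} - {k}. F ((f(k := Some x))(l := rmul ((f(k := Some x)) l) a)))"
    unfolding step_def using assms by (subst sum.remove[of _ k]) auto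
  also have "(\<Sum>l \<in> {..<m} - {k}. F ((f(k := Some x))(l := rmul ((f(k := Some x)) l) a)))
      = (\<Sum>l \<in> {..<m} - {k}. F (f(l := rmul (f l) a, k := Some x)))"
    by (intro sum.cong) (auto simp: fun_upd_twist)
  finally show ?thesis .
qed

lemma multilinear_step: "multilinear m F \<Longrightarrow> multilinear m (step m a F)"
  unfolding multilinear_def[of m "step m a F"]
  by (simp add: step_update multilinear_add multilinear_scale pr_add_left pr_scale_left
      sum.distrib sum_distrib_left distrib_left)

lemma multilinear_foldr: "multilinear m F \<Longrightarrow> multilinear m (foldr (step m) w F)"
  by (induction w) (auto intro: multilinear_step)

lemma step_zero: "step m a (\<lambda>f. 0) = (\<lambda>f. 0)"
  by (simp add: step_def)

lemma foldr_zero: "foldr (step m) w (\<lambda>f. 0) = (\<lambda>f. 0)"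
  by (induction w) (auto simp: step_zero)

lemma foldr_add: "foldr (step m) w (\<lambda>f. F f + G f) = (\<lambda>f. foldr (step m) w F f + foldr (step m) w G f)"
  by (induction w) (auto simp: step_def sum.distrib)

lemma foldr_scale: "foldr (step m) w (\<lambda>f. c * F f) = (\<lambda>f. c * foldr (step m) w F f)"
  by (induction w) (auto simp: step_def sum_distrib_left)

lemma act_zero: "act m 0 F = (\<lambda>f. 0)" and act_zero_right: "act m p (\<lambda>f. 0) = (\<lambda>f. 0)"
  by (simp_all add: act_def foldr_zero)

lemma act_add: "act m (p + q) F = (\<lambda>f. act m p F f + act m q F f)"
  unfolding act_def by (intro ext setsum_keys_plus_distrib) (simp_all add: algebra_simps)

lemma act_uminus: "act m (- p) F = (\<lambda>f. - act m p F f)"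
proof
  fix f
  show "act m (- p) F f = - act m p F f"
    using fun_cong[OF act_add[of m p "- p" F], of f] by (simp add: act_zero eq_neg_iff_add_eq_0 add.commute)
qed

lemma act_diff: "act m (p - q) F = (\<lambda>f. act m p F f - act m q F f)"
  using act_add[of m p "- q" F] by (simp add: act_uminus)

lemma act_single: "act m (Poly_Mapping.single (Word w) c) F = (\<lambda>f. c * foldr (step m) w F f)"
  by (simp add: act_def)

lemma act_gen [simp]: "act m (gen a) F = step m a F"
  by (simp add: gen_def act_single)

lemma act_const [simp]: "act m (const c) F = (\<lambda>f. c * F f)"
  by (simp add: act_single flip: single_Nil)

lemma act_mult: "act m (p * q) F = act m p (act m q F)"
proof (induction p rule: free_algebra_induct)
  case (single v c)
  show ?case
  proof (induction q rule: free_algebra_induct)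
    case (single w d)
    then show ?case
      by (simp add: mult_single plus_word_def act_single foldr_scale mult.assoc)
  qed (simp add: distrib_left act_add act_single foldr_add)
qed (simp add: distrib_right act_add)

lemma multilinear_act: "multilinear m F \<Longrightarrow> multilinear m (act m p F)"
proof (induction p rule: free_algebra_induct)
  case (add p q)
  then show ?case by (simp add: act_add multilinear_def algebra_simps)
next
  case (single w c)
  then have "multilinear m (foldr (step m) w F)" by (rule multilinear_foldr)
  then show ?case by (simp add: act_single multilinear_def algebra_simps)
qed

lemma step_add_letter:
  assumes "multilinear m F" shows "step m (a + b) F f = step m a F f + step m b F f"
proof -
  have "F (f(k := rmul (f k) (a + b))) = F (f(k := rmul (f k) a)) + F (f(k := rmul (f k) b))" if "k < m" for k
    using that assms by (cases "f k") (simp_all add: pr_add_right multilinear_add)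
  then show ?thesis by (simp add: step_def flip: sum.distrib)
qed

lemma step_scale_letter:
  assumes "multilinear m F" shows "step m (scale c a) F f = c * step m a F f"
proof -
  have "F (f(k := rmul (f k) (scale c a))) = c * F (f(k := rmul (f k) a))" if "k < m" for k
    using that assms by (cases "f k") (simp_all add: pr_scale_right multilinear_scale)
  then show ?thesis by (simp add: step_def sum_distrib_left)
qed

lemma rmul_Some: "\<exists>x. rmul y a = Some x"
  by (cases y) auto

lemma step_step:
  "step m a (step m b F) f =
     (\<Sum>k<m. F (f(k := rmul (rmul (f k) a) b)))
     + (\<Sum>k<m. \<Sum>l \<in> {..<m} - {k}. F (f(l := rmul (f l) b, k := rmul (f k) a)))"
proof -
  have "step m b F (f(k := rmul (f k) a)) = F (f(k := rmul (rmul (f k) a) b))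
      + (\<Sum>l \<in> {..<m} - {k}. F (f(l := rmul (f l) b, k := rmul (f k) a)))" if "k < m" for k
  proof -
    obtain x where x: "rmul (f k) a = Some x" using rmul_Some by blast
    show ?thesis unfolding x using step_update[OF that, of b F f x] by simp
  qed
  then show ?thesis unfolding step_def[of m a] by (simp add: sum.distrib)
qed

text \<open>
  The terms in which \<open>a\<close> and \<open>b\<close> are multiplied into different arguments cancel in the commutator.
\<close>
lemma step_bracket:
  assumes "multilinear m F"
  shows "step m a (step m b F) f - step m b (step m a F) f = step m (lbracket L a b) F f"
proof -
  let ?g = "\<lambda>a b k l. F (f(l := rmul (f l) b, k := rmul (f k) a))"
  have swap: "(\<Sum>k<m. \<Sum>l \<in> {..<m} - {k}. ?g a b k l) = (\<Sum>k<m. \<Sum>l \<in> {..<m} - {k}. ?g b a k l)"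
  proof -
    have "(\<Sum>k<m. \<Sum>l \<in> {..<m} - {k}. ?g a b k l) = (\<Sum>k<m. \<Sum>l \<in> {l \<in> {..<m}. l \<noteq> k}. ?g a b k l)"
      by (intro sum.cong) auto
    also have "\<dots> = (\<Sum>l<m. \<Sum>k \<in> {k \<in> {..<m}. l \<noteq> k}. ?g a b k l)"
      by (rule sum.swap_restrict) auto
    also have "\<dots> = (\<Sum>l<m. \<Sum>k \<in> {..<m} - {l}. ?g b a l k)"
      by (intro sum.cong) (auto simp: fun_upd_twist)
    finally show ?thesis .
  qed
  have "F (f(k := rmul (rmul (f k) a) b)) - F (f(k := rmul (rmul (f k) b) a))
      = F (f(k := rmul (f k) (lbracket L a b)))" if "k < m" for k
    using that assms by (cases "f k") (simp_all add: lbracket_eq pr_assoc pr_diff_right multilinear_diff)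
  then have "(\<Sum>k<m. F (f(k := rmul (rmul (f k) a) b))) - (\<Sum>k<m. F (f(k := rmul (rmul (f k) b) a)))
      = step m (lbracket L a b) F f"
    by (simp add: step_def flip: sum_subtractf)
  then show ?thesis unfolding step_step swap by simp
qed

text \<open>The enveloping algebra acts on the multilinear functionals.\<close>
lemma act_J:
  assumes "p \<in> J" "multilinear m F"
  shows "act m p F = (\<lambda>f. 0)"
proof -
  have "J \<subseteq> {p. \<forall>F. multilinear m F \<longrightarrow> act m p F = (\<lambda>f. 0)}"
    by (rule J_minimal)
      (auto simp: act_zero act_diff act_mult act_zero_right multilinear_act multilinear_step
        step_add_letter step_scale_letter step_bracket)
  then show ?thesis using assms by blast
qed

subsection \<open>Dual functionals\<close>

text \<open>
  Products of functionals of one argument. If the factors vanish at the unit, then they detect leading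
  terms: at the configuration whose arguments are all units, words with fewer than \<open>m\<close> letters act as zero, and a
  word of \<open>m\<close> basis elements is detected precisely by the product of the coordinate functionals of
  any arrangement of its letters.
\<close>
abbreviation product_functional :: "nat \<Rightarrow> (nat \<Rightarrow> 'g option \<Rightarrow> complex) \<Rightarrow> (nat \<Rightarrow> 'g option) \<Rightarrow> complex" where
  "product_functional m \<beta> \<equiv> (\<lambda>f. \<Prod>k<m. \<beta> k (f k))"

lemma multilinear_product_functional:
  assumes "\<And>k a b. k < m \<Longrightarrow> \<beta> k (Some (a + b)) = \<beta> k (Some a) + \<beta> k (Some b)"
    and "\<And>k c a. k < m \<Longrightarrow> \<beta> k (Some (scale c a)) = c * \<beta> k (Some a)"
  shows "multilinear m (product_functional m \<beta>)"
proof -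
  have "(\<Prod>l<m. \<beta> l ((f(k := y)) l)) = \<beta> k y * (\<Prod>l \<in> {..<m} - {k}. \<beta> l (f l))" if "k < m" for f k y
    using that by (subst prod.remove[of _ k]) (auto intro!: prod.cong)
  then show ?thesis unfolding multilinear_def using assms by (simp add: algebra_simps)
qed

text \<open>The positions at which a configuration is the unit.\<close>
definition units :: "nat \<Rightarrow> (nat \<Rightarrow> 'g option) \<Rightarrow> nat set" where
  "units m f = {k. k < m \<and> f k = None}"

lemma finite_units [simp]: "finite (units m f)"
  by (simp add: units_def)

lemma units_update: "units m (f(k := rmul (f k) a)) = units m f - {k}"
  using rmul_Some[of "f k" a] by (auto simp: units_def)

lemma foldr_step_Cons:
  "foldr (step m) (a # w) F f = (\<Sum>k<m. foldr (step m) w F (f(k := rmul (f k) a)))"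
  by (simp add: step_def[of m a])

lemma act_few_letters:
  assumes "\<And>k. \<beta> k None = 0" "length w < card (units m f)"
  shows "foldr (step m) w (product_functional m \<beta>) f = 0"
  using assms(2)
proof (induction w arbitrary: f)
  case Nil
  then obtain k where "k \<in> units m f" by (metis card_gt_0_iff ex_in_conv list.size(3))
  then have "k < m" "\<beta> k (f k) = 0" using assms(1) by (simp_all add: units_def)
  then show ?case by (simp add: prod_zero_iff) blast
next
  case (Cons a w)
  have "foldr (step m) w (product_functional m \<beta>) (f(k := rmul (f k) a)) = 0" for k
    using Cons.prems by (intro Cons.IH) (auto simp: units_update card_Diff_singleton_if simp del: fun_upd_apply)
  then show ?case unfolding foldr_step_Cons by simp
qed

text \<open>
  If a word of basis elements is just long enough to fill all units, then each letter must go to a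
  unit of its own. The value counts the ways of doing this such that position \<open>k\<close> receives \<open>c k\<close>;
  being a natural number, it cannot vanish by cancellation.
\<close>
lemma act_matching:
  assumes unit: "\<And>k. \<beta> k None = 0"
    and dual: "\<And>k b. k < m \<Longrightarrow> b \<in> B \<Longrightarrow> \<beta> k (Some b) = (if b = c k then 1 else 0)"
    and "set w \<subseteq> B" "\<And>k. k < m \<Longrightarrow> f k = None \<or> (\<exists>b \<in> B. f k = Some b)"
    and "length w = card (units m f)"
  shows "\<exists>n::nat. foldr (step m) w (product_functional m \<beta>) f = of_nat n \<and>
    (n > 0 \<longleftrightarrow> mset w = image_mset c (mset_set (units m f)) \<and>
       (\<forall>k<m. k \<notin> units m f \<longrightarrow> f k = Some (c k)))"
  using assms(3-)
proof (induction w arbitrary: f)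
  case Nil
  then have no: "units m f = {}" by simp
  then have f: "f k \<noteq> None" if "k < m" for k using that by (auto simp: units_def)
  have b: "\<beta> k (f k) = (if f k = Some (c k) then 1 else 0)" if "k < m" for k
    using Nil.prems(2)[OF that] f[OF that] dual[OF that] by auto
  show ?case
  proof (cases "\<forall>k<m. f k = Some (c k)")
    case True
    then have "product_functional m \<beta> f = 1" using b by simp
    then show ?thesis using True no by (intro exI[of _ 1]) simp
  next
    case False
    then have "product_functional m \<beta> f = 0" using b by (auto intro!: prod_zero)
    then show ?thesis using False no by (intro exI[of _ 0]) auto
  qed
next
  case (Cons a w)
  let ?F = "product_functional m \<beta>"
  let ?f = "\<lambda>k. f(k := rmul (f k) a)"
  let ?ok = "\<lambda>f. \<forall>k<m. k \<notin> units m f \<longrightarrow> f k = Some (c k)"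
  let ?M = "\<lambda>f. image_mset c (mset_set (units m f))"
  have zero: "foldr (step m) w ?F (?f k) = 0" if "k \<notin> units m f" for k
    using Cons.prems(3) that by (intro act_few_letters unit) (unfold units_update, simp)
  have "\<exists>n::nat. foldr (step m) w ?F (?f k) = of_nat n \<and> (n > 0 \<longleftrightarrow> mset w = ?M (?f k) \<and> ?ok (?f k))"
    if "k \<in> units m f" for k
  proof (rule Cons.IH)
    show "length w = card (units m (?f k))"
      using Cons.prems(3) that by (simp add: units_update)
    fix l assume "l < m"
    then show "?f k l = None \<or> (\<exists>b \<in> B. ?f k l = Some b)"
      using Cons.prems(1,2) that by (auto simp: units_def)
  qed (use Cons.prems in auto)
  then have "\<forall>k \<in> units m f. \<exists>n::nat. foldr (step m) w ?F (?f k) = of_nat n \<and>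
      (n > 0 \<longleftrightarrow> mset w = ?M (?f k) \<and> ?ok (?f k))" by blast
  from bchoice[OF this] obtain n :: "nat \<Rightarrow> nat"
    where n: "\<And>k. k \<in> units m f \<Longrightarrow> foldr (step m) w ?F (?f k) = of_nat (n k)"
      and pos: "\<And>k. k \<in> units m f \<Longrightarrow> n k > 0 \<longleftrightarrow> mset w = ?M (?f k) \<and> ?ok (?f k)"
    by blast
  have "foldr (step m) (a # w) ?F f = (\<Sum>k<m. foldr (step m) w ?F (?f k))"
    by (rule foldr_step_Cons)
  also have "\<dots> = (\<Sum>k \<in> units m f. foldr (step m) w ?F (?f k))"
    using zero by (intro sum.mono_neutral_right) (auto simp: units_def)
  also have "\<dots> = of_nat (\<Sum>k \<in> units m f. n k)"
    by (simp add: n)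
  finally have eq: "foldr (step m) (a # w) ?F f = of_nat (\<Sum>k \<in> units m f. n k)" .
  have M: "?M f = add_mset (c k) (?M (?f k))" if "k \<in> units m f" for k
    using that by (simp add: units_update mset_set.remove)
  have ok: "?ok (?f k) \<longleftrightarrow> ?ok f \<and> a = c k" if "k \<in> units m f" for k
    using that unfolding units_update by (auto simp: units_def)
  have "(\<Sum>k \<in> units m f. n k) > 0 \<longleftrightarrow> (\<exists>k \<in> units m f. n k > 0)"
    by (metis finite_units gr0I less_numeral_extra(3) sum_eq_0_iff)
  also have "\<dots> \<longleftrightarrow> (\<exists>k \<in> units m f. mset w = ?M (?f k) \<and> ?ok f \<and> a = c k)"
    using pos ok by blast
  also have "\<dots> \<longleftrightarrow> mset (a # w) = ?M f \<and> ?ok f"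
  proof
    assume "\<exists>k \<in> units m f. mset w = ?M (?f k) \<and> ?ok f \<and> a = c k"
    then show "mset (a # w) = ?M f \<and> ?ok f" using M by auto
  next
    assume *: "mset (a # w) = ?M f \<and> ?ok f"
    then have "a \<in># ?M f" by (metis list.set_intros(1) set_mset_mset)
    then obtain k where k: "k \<in> units m f" "a = c k" by auto
    then have "mset w = ?M (?f k)" using M[of k] * by simp
    then show "\<exists>k \<in> units m f. mset w = ?M (?f k) \<and> ?ok f \<and> a = c k" using k * by blast
  qed
  finally show ?case by (intro exI[of _ "\<Sum>k \<in> units m f. n k"] conjI eq)
qed

lemma act_word_dual:
  assumes "\<And>k. \<beta> k None = 0"
    and "\<And>k b. k < length v \<Longrightarrow> b \<in> B \<Longrightarrow> \<beta> k (Some b) = (if b = v ! k then 1 else 0)"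
    and "set w \<subseteq> B" "length w \<le> length v"
  shows "foldr (step (length v)) w (product_functional (length v) \<beta>) (\<lambda>_. None) \<noteq> 0 \<longleftrightarrow> mset w = mset v"
proof (cases "length w = length v")
  case True
  have u: "units (length v) (\<lambda>_. None) = {..<length v}" by (auto simp: units_def)
  have "image_mset ((!) v) (mset_set {..<length v}) = mset (map ((!) v) [0..<length v])"
    by (simp add: mset_upt atLeast0LessThan)
  also have "\<dots> = mset v" by (simp add: map_nth)
  finally show ?thesis
    using act_matching[of \<beta> "length v" B "(!) v" w "\<lambda>_. None"] assms True by (auto simp: u)
next
  case False
  have u: "units (length v) (\<lambda>_. None) = {..<length v}" by (auto simp: units_def)
  have "foldr (step (length v)) w (product_functional (length v) \<beta>) (\<lambda>_. None) = 0"
    using False assms by (intro act_few_letters) (auto simp: u)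
  moreover have "mset w \<noteq> mset v" using False by (metis size_mset)
  ultimately show ?thesis by simp
qed

end

section \<open>The Lie algebras of matrices\<close>

text \<open>
  Scalar multiplication of matrices, and the product of matrices of size \<open>N\<close>. The latter is
  associative on all functions of two indices, whatever their entries outside the range.
\<close>
definition mscale :: "complex \<Rightarrow> 'a::complex_assoc_algebra matrix \<Rightarrow> 'a matrix" where
  "mscale c A = (\<lambda>i j. c *\<^sub>C A i j)"

definition mmul :: "nat \<Rightarrow> 'a::complex_assoc_algebra matrix \<Rightarrow> 'a matrix \<Rightarrow> 'a matrix" where
  "mmul N A B = (\<lambda>i j. \<Sum>k = 1..N. A i k * B k j)"

lemma scaleC_zero [simp]: "c *\<^sub>C (0 :: 'a::complex_assoc_algebra) = 0" "0 *\<^sub>C (x :: 'a) = 0"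
  and scaleC_sum: "c *\<^sub>C (\<Sum>k\<in>A. f k) = (\<Sum>k\<in>A. c *\<^sub>C (f k :: 'a))"
  and scaleC_diff: "c *\<^sub>C (x - y) = c *\<^sub>C x - c *\<^sub>C (y :: 'a)"
  by (simp_all add: complex_space.scale_sum_right complex_space.scale_right_diff_distrib)

lemma in_gl_iff: "A \<in> lcarrier (gl N) \<longleftrightarrow> (\<forall>i j. \<not> (i \<in> {1..N} \<and> j \<in> {1..N}) \<longrightarrow> A i j = 0)"
  unfolding gl_def by (simp, blast)

lemma mmul_in_gl: "A \<in> lcarrier (gl N) \<Longrightarrow> B \<in> lcarrier (gl N) \<Longrightarrow> mmul N A B \<in> lcarrier (gl N)"
  unfolding in_gl_iff by (auto simp: mmul_def intro!: sum.neutral)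

lemma lbracket_gl: "lbracket (gl N) A B = mmul N A B - mmul N B A"
  by (simp add: gl_def mmul_def fun_eq_iff)

lemma ladd_gl: "ladd (gl N) = (+)" and lscale_gl: "lscale (gl N) = mscale"
  by (simp_all add: gl_def mscale_def fun_eq_iff)

lemma mmul_assoc: "mmul N (mmul N A B) C = mmul N A (mmul N B C)"
proof (intro ext)
  fix i j
  show "mmul N (mmul N A B) C i j = mmul N A (mmul N B C) i j"
    unfolding mmul_def sum_distrib_right sum_distrib_left mult.assoc by (rule sum.swap)
qed

global_interpretation gl: commutator_lie_algebra mscale "gl N" "mmul N" for N
proof -
  interpret V: Vector_Spaces.vector_space "mscale :: complex \<Rightarrow> 'a matrix \<Rightarrow> 'a matrix"
    by unfold_locales
      (simp_all add: mscale_def fun_eq_iff scaleC_add_right scaleC_add_left scaleC_scaleC scaleC_one)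
  have add: "mmul N (A + B) C = mmul N A C + mmul N B C" "mmul N C (A + B) = mmul N C A + mmul N C B"
    for A B C :: "'a matrix"
    by (simp_all add: mmul_def fun_eq_iff distrib_left distrib_right sum.distrib)
  have scale: "mmul N (mscale c A) B = mscale c (mmul N A B)" "mmul N A (mscale c B) = mscale c (mmul N A B)"
    for c and A B :: "'a matrix"
    by (simp_all add: mmul_def mscale_def fun_eq_iff scaleC_sum scaleC_mult_left scaleC_mult_right)
  have sub: "V.subspace (lcarrier (gl N))"
    by (auto simp: V.subspace_def in_gl_iff mscale_def)
  have closed: "A - B \<in> lcarrier (gl N)" if "A \<in> lcarrier (gl N)" "B \<in> lcarrier (gl N)" for A B :: "'a matrix"
    using that unfolding in_gl_iff by auto
  show "commutator_lie_algebra (mscale :: complex \<Rightarrow> 'a matrix \<Rightarrow> 'a matrix) (gl N) (mmul N)"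
    by unfold_locales
      (simp_all only: sub add scale mmul_assoc lbracket_gl ladd_gl lscale_gl closed mmul_in_gl)
qed

lemma gl_mono: "M \<le> N \<Longrightarrow> lcarrier (gl M) \<subseteq> lcarrier (gl N)"
  unfolding gl_def by fastforce

lemma uea_ideal_gl_mono:
  assumes "M \<le> N"
  shows "uea_ideal (gl M :: 'a::complex_assoc_algebra matrix lie_algebra) \<subseteq> uea_ideal (gl N)"
proof (rule gl.J_minimal)
  have sub: "free_carrier (lcarrier (gl M)) \<subseteq> free_carrier (lcarrier (gl N :: 'a matrix lie_algebra))"
    using assms by (intro free_carrier_mono gl_mono)
  have mono: "A \<in> lcarrier (gl N)" if "A \<in> lcarrier (gl M)" for A :: "'a matrix"
    using gl_mono[OF assms] that by blast
  show "p * q \<in> uea_ideal (gl N)" "q * p \<in> uea_ideal (gl N)"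
    if "p \<in> free_carrier (lcarrier (gl M))" "q \<in> uea_ideal (gl N)" for p q :: "'a matrix free_algebra"
    using that sub by auto
  fix A B :: "'a matrix" and c
  assume A: "A \<in> lcarrier (gl M)"
  show "gen (mscale c A) - const c * gen A \<in> uea_ideal (gl N)"
    using mono A by (intro gl.J_gen_scale) auto
  assume B: "B \<in> lcarrier (gl M)"
  show "gen (A + B) - gen A - gen B \<in> uea_ideal (gl N)"
    using mono A B by (intro gl.J_gen_add) auto
  have "mmul M A B = mmul N A B" if "A \<in> lcarrier (gl M)" "B \<in> lcarrier (gl M)" for A B :: "'a matrix"
    unfolding mmul_def using assms that by (intro ext sum.mono_neutral_left) (auto simp: in_gl_iff)
  then have "lbracket (gl M) A B = lbracket (gl N) A B"
    using A B by (simp add: lbracket_gl)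
  then show "gen A * gen B - gen B * gen A - gen (lbracket (gl M) A B) \<in> uea_ideal (gl N)"
    using mono A B by (auto intro: gl.J_gen_bracket)
qed auto

section \<open>The left ideal and the smaller enveloping algebra meet trivially\<close>

lemma (in ambient_lie_algebra) additive_subgroup_class_image:
  assumes "K \<subseteq> free_carrier S" "0 \<in> K" "\<And>p q. p \<in> K \<Longrightarrow> q \<in> K \<Longrightarrow> p - q \<in> K"
  shows "additive_subgroup (uea_class L ` K) (uea L)"
proof -
  interpret h: ring_hom_ring "free_algebra S" "uea L" "uea_class L"
    by (intro ring_hom_ringI2 ring_free_algebra ring_uea class_hom)
  show ?thesis
    using h.img_is_add_subgroup[OF subgroup_free_algebraI[OF assms]] by (simp add: additive_subgroupI)
qed

text \<open>
  The functionals below only see the first \<open>N - 1\<close> columns, whereas right multiplication by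
  \<open>E\<^sub>i\<^sub>N(x)\<close> has its image in column \<open>N\<close>. This is why they vanish on \<open>I_plus N\<close>.
\<close>
lemma act_I_plus:
  fixes F :: "(nat \<Rightarrow> 'a::complex_assoc_algebra matrix option) \<Rightarrow> complex"
  assumes F: "gl.multilinear m F"
    and kill: "\<And>f k A. k < m \<Longrightarrow> (\<And>i j. j \<noteq> N \<Longrightarrow> A i j = 0) \<Longrightarrow> F (f(k := Some A)) = 0"
    and p: "uea_class (gl N) p \<in> I_plus N"
  shows "gl.act N m p F = (\<lambda>f. 0)"
proof -
  define K where "K = {p \<in> free_carrier (lcarrier (gl N)). gl.act N m p F = (\<lambda>f. 0)}"
  have "\<exists>A. gl.rmul N y (mat_unit i N x) = Some A \<and> (\<forall>i j. j \<noteq> N \<longrightarrow> A i j = 0)" for y i and x :: 'a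
    by (cases y) (auto simp: mat_unit_def mmul_def)
  then have "gl.step N m (mat_unit i N x) F = (\<lambda>f. 0)" for i x
    unfolding gl.step_def using kill by (intro ext sum.neutral ballI) (metis lessThan_iff)
  moreover have unit: "mat_unit i N x \<in> lcarrier (gl N)" if "i \<in> {1..N}" for i and x :: 'a
    using that by (auto simp: in_gl_iff mat_unit_def)
  ultimately have gens: "E N i N x \<in> uea_class (gl N) ` K" if "i \<in> {1..N}" for i x
    unfolding E_def uea_gen_def using that unit by (intro imageI) (simp add: K_def free_carrier_gen)
  have "r \<otimes>\<^bsub>Ugl N\<^esub> u \<in> uea_class (gl N) ` K" 
    if r: "r \<in> carrier (Ugl N)" and u: "u \<in> uea_class (gl N) ` K" for r u
  proof -
    have "r \<in> uea_class (gl N) ` free_carrier (lcarrier (gl N))"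
      using r by (simp only: gl.carrier_uea)
    then obtain q where q: "r = uea_class (gl N) q" "q \<in> free_carrier (lcarrier (gl N))"
      by (rule imageE)
    obtain q' where q': "u = uea_class (gl N) q'" "q' \<in> K"
      using u by (rule imageE)
    have "q * q' \<in> K" "q' \<in> free_carrier (lcarrier (gl N))"
      using q(2) q'(2) by (auto simp: K_def gl.act_mult gl.act_zero_right)
    then show ?thesis
      unfolding q(1) q'(1) by (subst gl.class_mult[symmetric]) (use q(2) in auto)
  qed
  moreover have "additive_subgroup (uea_class (gl N) ` K) (Ugl N)"
    by (rule gl.additive_subgroup_class_image) (auto simp: K_def gl.act_zero gl.act_diff)
  ultimately have "I_plus N \<subseteq> uea_class (gl N) ` K"
    unfolding I_plus_def left_ideal_gen_def using gens by blast
  then obtain q where q: "q \<in> K" "uea_class (gl N) p = uea_class (gl N) q" using p by blast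
  then have "gl.act N m (p - q) F = (\<lambda>f. 0)"
    using F by (intro gl.act_J) (simp add: gl.class_eq_iff)
  then show ?thesis using q by (simp add: K_def gl.act_diff fun_eq_iff)
qed

text \<open>
  This also contains the injectivity of the map between the enveloping algebras: an element of the
  smaller one that vanishes in the larger one satisfies the hypothesis.
\<close>
lemma gl_subalgebra_Int_I_plus:
  fixes p :: "'a::complex_assoc_algebra matrix free_algebra"
  assumes p: "p \<in> free_carrier (lcarrier (gl (N - 1)))" and I: "uea_class (gl N) p \<in> I_plus N"
  shows "p \<in> uea_ideal (gl (N - 1))"
proof -
  let ?M = "N - 1"
  let ?S = "lcarrier (gl ?M) :: 'a matrix set"
  obtain B where B: "B \<subseteq> ?S" "gl.independent B" "?S \<subseteq> gl.span B"
    using gl.maximal_independent_subset[of ?S] by metis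
  obtain q where q: "Poly_Mapping.keys q \<subseteq> arranged B" "p - q \<in> uea_ideal (gl ?M)"
    using gl.reducible_all[OF B(1,3) p] unfolding gl.reducible_def by blast
  have "q = 0"
  proof (rule ccontr)
    assume "q \<noteq> 0"
    let ?len = "\<lambda>w. length (letters w)"
    let ?K = "Poly_Mapping.keys q"
    have "?K \<noteq> {}" using \<open>q \<noteq> 0\<close> by simp
    then have "Max (?len ` ?K) \<in> ?len ` ?K" by (intro Max_in) auto
    then obtain w0 where "w0 \<in> ?K" "?len w0 = Max (?len ` ?K)" by auto
    then have w0: "w0 \<in> ?K" "\<And>w. w \<in> ?K \<Longrightarrow> ?len w \<le> ?len w0" by auto
    define v where "v = letters w0"
    \<comment> \<open>\<open>w0\<close> is a longest word in \<open>q\<close>; its coordinate functionals are extended to all matrices by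
      cutting out the upper left block.\<close>
    define cut where "cut A = (\<lambda>i j. if i \<in> {1..?M} \<and> j \<in> {1..?M} then A i j else 0)" for A :: "'a matrix"
    have cut_span: "cut A \<in> gl.span B" for A
    proof -
      have "cut A \<in> ?S" unfolding in_gl_iff cut_def by simp
      then show ?thesis using B(3) by blast
    qed
    have cut_id: "cut A = A" if "A \<in> B" for A
    proof -
      have "A \<in> ?S" using that B(1) by blast
      then show ?thesis unfolding in_gl_iff cut_def by (intro ext) simp
    qed
    have cut_add: "cut (A + A') = cut A + cut A'" and cut_scale: "cut (mscale c A) = mscale c (cut A)"
      for A A' c
      by (auto simp: cut_def mscale_def fun_eq_iff)
    define \<beta> where "\<beta> k y = (case y of None \<Rightarrow> 0 | Some A \<Rightarrow> gl.representation B (cut A) (v ! k))" for k y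
    let ?F = "gl.product_functional (length v) \<beta>"
    have F: "gl.multilinear (length v) ?F"
      by (rule gl.multilinear_product_functional)
        (simp_all add: \<beta>_def cut_add cut_scale gl.representation_add gl.representation_scale B(2) cut_span)
    have kill: "?F (f(k := Some A)) = 0" if "k < length v" "\<And>i j. j \<noteq> N \<Longrightarrow> A i j = 0" for f k A
    proof -
      have "cut A = 0" using that(2) by (auto simp: cut_def fun_eq_iff)
      then have "\<beta> k ((f(k := Some A)) k) = 0" by (simp add: \<beta>_def gl.representation_zero)
      then show ?thesis using that(1) by (simp add: prod_zero_iff) blast
    qed
    have "gl.act N (length v) p ?F = (\<lambda>f. 0)"
      by (rule act_I_plus[OF F kill I])
    moreover have "gl.act N (length v) (p - q) ?F = (\<lambda>f. 0)"
      using q(2) uea_ideal_gl_mono[of ?M N] F by (intro gl.act_J) auto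
    ultimately have "gl.act N (length v) q ?F (\<lambda>_. None) = 0"
      by (simp add: gl.act_diff fun_eq_iff)
    moreover have "gl.act N (length v) q ?F (\<lambda>_. None) =
        Poly_Mapping.lookup q w0 * foldr (gl.step N (length v)) v ?F (\<lambda>_. None)"
    proof -
      have dual: "foldr (gl.step N (length v)) (letters w) ?F (\<lambda>_. None) \<noteq> 0 \<longleftrightarrow> mset (letters w) = mset v"
        if "w \<in> ?K" for w
      proof (rule gl.act_word_dual[where B = B])
        have "w \<in> arranged B" "w0 \<in> arranged B" using that w0 q(1) by auto
        then show "set (letters w) \<subseteq> B" by (auto simp: arranged_def)
        show "length (letters w) \<le> length v" using w0(2)[OF that] by (simp add: v_def)
      qed (use B(2) in \<open>auto simp: \<beta>_def cut_id gl.representation_basis\<close>)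
      have "foldr (gl.step N (length v)) (letters w) ?F (\<lambda>_. None) = 0" if "w \<in> ?K - {w0}" for w
      proof -
        have "Word (letters w) \<in> arranged B" "Word v \<in> arranged B" using that w0 q(1) by (auto simp: v_def)
        then have "mset (letters w) \<noteq> mset v"
          using that arranged_eqI[of "letters w" B v] by (auto simp: v_def word.expand)
        then show ?thesis using dual that by blast
      qed
      then show ?thesis
        unfolding gl.act_def using w0(1) by (subst sum.remove[of _ w0]) (simp_all add: v_def)
    qed
    moreover have "foldr (gl.step N (length v)) v ?F (\<lambda>_. None) \<noteq> 0"
    proof -
      have "w0 \<in> arranged B" using w0 q(1) by auto
      then have "set v \<subseteq> B" by (auto simp: arranged_def v_def)
      then show ?thesis
        by (subst gl.act_word_dual[where B = B])
          (use B(2) in \<open>auto simp: \<beta>_def cut_id gl.representation_basis\<close>)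
    qed
    ultimately show False using w0(1) by (simp add: in_keys_iff)
  qed
  then show ?thesis using q(2) by simp
qed

section \<open>A recursion for the elements \<open>t\<close>\<close>

text \<open>The generator \<open>E\<^sub>i\<^sub>j(x)\<close> of the free algebra.\<close>
abbreviation eg :: "nat \<Rightarrow> nat \<Rightarrow> 'a::complex_assoc_algebra \<Rightarrow> 'a matrix free_algebra" where
  "eg i j x \<equiv> gen (mat_unit i j x)"

text \<open>
  For nonempty \<open>xs\<close>, indices \<open>i, j\<close> up to \<open>M\<close> and \<open>c = - M - s\<close>, a representative of \<open>t_elem i j xs M s\<close>. Between two
  consecutive letters there is either a summation over an intermediate index or a multiplication in
  the algebra of coefficients, weighted by \<open>c\<close>; the recursion decides this for the first two letters.
  The parameters \<open>M\<close> and \<open>c\<close> are independent, so that the weight can be changed along with the size.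
\<close>
function t_rep :: "nat \<Rightarrow> complex \<Rightarrow> nat \<Rightarrow> nat \<Rightarrow> 'a::complex_assoc_algebra list \<Rightarrow> 'a matrix free_algebra" where
  "t_rep M c i j [] = 0"
| "t_rep M c i j [x] = eg i j x"
| "t_rep M c i j (x # y # r) =
     (\<Sum>a = 1..M. eg i a x * t_rep M c a j (y # r)) + const c * t_rep M c i j (x * y # r)"
  by pat_completeness auto
termination by (relation "measure (\<lambda>(M, c, i, j, xs). length xs)") auto

lemma t_rep_Cons:
  "xs \<noteq> [] \<Longrightarrow> t_rep M c i j (x # xs) =
     (\<Sum>a = 1..M. eg i a x * t_rep M c a j xs) + const c * t_rep M c i j (x * hd xs # tl xs)"
  by (cases xs) auto

text \<open>The recursion at the last gap.\<close>
lemma t_rep_snoc: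
  "t_rep M c i j (r @ [y, x]) =
     (\<Sum>a = 1..M. t_rep M c i a (r @ [y]) * eg a j x) + const c * t_rep M c i j (r @ [y * x])"
proof (induction "length r" arbitrary: r i y rule: less_induct)
  case less
  have exchange: "(\<Sum>b = 1..M. e b * ((\<Sum>a = 1..M. P b a * g a) + const c * Q b)) + const c * ((\<Sum>a = 1..M. R a * g a) + const c * Z)
     = (\<Sum>a = 1..M. ((\<Sum>b = 1..M. e b * P b a) + const c * R a) * g a) + const c * ((\<Sum>b = 1..M. e b * Q b) + const c * Z)"
    for e g Q R Z and P :: "nat \<Rightarrow> nat \<Rightarrow> 'a matrix free_algebra"
  proof -
    have "e b * (const c * Q b) = const c * (e b * Q b)" for b
      by (metis const_commute mult.assoc)
    moreover have "(\<Sum>b = 1..M. \<Sum>a = 1..M. e b * (P b a * g a)) = (\<Sum>a = 1..M. \<Sum>b = 1..M. e b * (P b a * g a))"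
      by (rule sum.swap)
    ultimately show ?thesis
      by (simp add: distrib_left distrib_right sum.distrib sum_distrib_left sum_distrib_right mult.assoc)
  qed
  show ?case
  proof (cases r)
    case Nil
    then show ?thesis by simp
  next
    case (Cons u r')
    \<comment> \<open>Multiplying \<open>u\<close> into the rest of the word does not disturb the last gap.\<close>
    obtain r'' y' where merged: "length r'' < length r"
      "u * hd (r' @ [y, x]) # tl (r' @ [y, x]) = r'' @ [y', x]"
      "u * hd (r' @ [y]) # tl (r' @ [y]) = r'' @ [y']"
      "u * hd (r' @ [y * x]) # tl (r' @ [y * x]) = r'' @ [y' * x]"
    proof (cases r')
      case Nil
      then show ?thesis using that[of "[]" "u * y"] Cons by (simp add: mult.assoc)
    next
      case (Cons h t)
      then show ?thesis using that[of "u * h # t" y] \<open>r = u # r'\<close> by simp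
    qed
    have IH: "t_rep M c b j (r' @ [y, x]) =
      (\<Sum>a = 1..M. t_rep M c b a (r' @ [y]) * eg a j x) + const c * t_rep M c b j (r' @ [y * x])" for b
      using Cons by (intro less) simp
    have IH': "t_rep M c i j (r'' @ [y', x]) =
      (\<Sum>a = 1..M. t_rep M c i a (r'' @ [y']) * eg a j x) + const c * t_rep M c i j (r'' @ [y' * x])"
      by (rule less[OF merged(1)])
    show ?thesis
      unfolding Cons append_Cons
      by (subst (1 2 3) t_rep_Cons) (simp_all only: merged IH IH' exchange, simp_all)
  qed
qed

lemma mat_unit_in_gl: "i \<in> {1..N} \<Longrightarrow> j \<in> {1..N} \<Longrightarrow> mat_unit i j x \<in> lcarrier (gl N)"
  by (auto simp: in_gl_iff mat_unit_def)

lemma eg_carrier [intro]: "i \<in> {1..N} \<Longrightarrow> j \<in> {1..N} \<Longrightarrow> eg i j x \<in> free_carrier (lcarrier (gl N))"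
  by (intro free_carrier_gen mat_unit_in_gl)

lemma t_rep_carrier [intro]:
  "M \<le> N \<Longrightarrow> i \<in> {1..N} \<Longrightarrow> j \<in> {1..N} \<Longrightarrow> t_rep M c i j xs \<in> free_carrier (lcarrier (gl N))"
  by (induction M c i j xs rule: t_rep.induct)
    (auto intro!: free_carrier_add free_carrier_mult free_carrier_sum eg_carrier simp del: One_nat_def)

lemma eg_commutator:
  assumes "i \<in> {1..N}" "j \<in> {1..N}" "k \<in> {1..N}" "l \<in> {1..N}"
  shows "eg i j x * eg k l y - eg k l y * eg i j x
    - ((if k = j then eg i l (x * y) else 0) - (if i = l then eg k j (y * x) else 0)) \<in> uea_ideal (gl N)"
proof -
  let ?A = "if k = j then mat_unit i l (x * y) else 0"
  let ?B = "if i = l then mat_unit k j (y * x) else 0"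
  have gl: "?A \<in> lcarrier (gl N)" "?B \<in> lcarrier (gl N)"
    using assms by (auto intro!: mat_unit_in_gl simp del: One_nat_def) (auto simp: in_gl_iff)
  have "lbracket (gl N) (mat_unit i j x) (mat_unit k l y) = ?A - ?B"
    using assms by (subst lbracket_mat_unit) (auto simp: fun_eq_iff)
  then have 1: "eg i j x * eg k l y - eg k l y * eg i j x - gen (?A - ?B) \<in> uea_ideal (gl N)"
    using gl.J_gen_bracket[OF mat_unit_in_gl[OF assms(1,2)] mat_unit_in_gl[OF assms(3,4)]] by metis
  have 2: "gen (?A - ?B) - (gen ?A - gen ?B) \<in> uea_ideal (gl N)"
    by (rule gl.J_gen_diff[OF gl])
  have 3: "gen ?A - (if k = j then eg i l (x * y) else 0) \<in> uea_ideal (gl N)"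
    and 4: "gen ?B - (if i = l then eg k j (y * x) else 0) \<in> uea_ideal (gl N)"
    using gl.J_gen_zero by auto
  show ?thesis
    using gl.J_add[OF gl.J_add[OF 1 2] gl.J_diff[OF 3 4]] by (simp add: algebra_simps)
qed

section \<open>Invariance under \<open>E\<^sub>N\<^sub>N\<close>\<close>

text \<open>The eigenvalue \<open>\<delta>\<^sub>i\<^sub>N - \<delta>\<^sub>j\<^sub>N\<close> of \<open>[E\<^sub>N\<^sub>N, -]\<close> on \<open>E\<^sub>i\<^sub>j(x)\<close>.\<close>
definition wt :: "nat \<Rightarrow> nat \<Rightarrow> nat \<Rightarrow> complex" where
  "wt N i j = of_bool (i = N) - of_bool (j = N)"

lemma gl_action_eq:
  assumes "N \<ge> 1"
  shows "gl_action N (mat_unit N N 1) A = (\<lambda>i j. wt N i j *\<^sub>C A i j)"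
proof (intro ext)
  fix i j
  have "(\<Sum>k = 1..N. mat_unit N N 1 i k *\<^sub>C A k j) = (\<Sum>k = 1..N. if k = N then of_bool (i = N) *\<^sub>C A N j else 0)"
    by (intro sum.cong) (auto simp: mat_unit_def)
  moreover have "(\<Sum>k = 1..N. mat_unit N N 1 k j *\<^sub>C A i k) = (\<Sum>k = 1..N. if k = N then of_bool (j = N) *\<^sub>C A i N else 0)"
    by (intro sum.cong) (auto simp: mat_unit_def)
  ultimately show "gl_action N (mat_unit N N 1) A i j = wt N i j *\<^sub>C A i j"
    using assms by (auto simp: gl_action_def wt_def scaleC_one complex_space.scale_minus_left)
qed

lemma gl_action_mat_unit:
  "N \<ge> 1 \<Longrightarrow> gl_action N (mat_unit N N 1) (mat_unit i j x) = mscale (wt N i j) (mat_unit i j x)"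
  by (subst gl_action_eq) (auto simp: mat_unit_def mscale_def fun_eq_iff)

lemma J_gl_action:
  assumes "N \<ge> 1" "p \<in> uea_ideal (gl N)"
  shows "free_derivation (gl_action N (mat_unit N N 1)) p \<in> uea_ideal (gl N)"
proof (rule gl.J_derivation[OF _ _ _ _ assms(2)]; unfold gl_action_eq[OF assms(1)])
  fix A B :: "'a matrix" and c
  have mul: "(\<lambda>i j. wt N i j *\<^sub>C mmul N A B i j) =
      mmul N (\<lambda>i j. wt N i j *\<^sub>C A i j) B + mmul N A (\<lambda>i j. wt N i j *\<^sub>C B i j)" for A B :: "'a matrix"
  proof (intro ext)
    fix i j
    have "wt N i j *\<^sub>C mmul N A B i j = (\<Sum>k = 1..N. wt N i k *\<^sub>C (A i k * B k j) + wt N k j *\<^sub>C (A i k * B k j))"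
      unfolding mmul_def scaleC_sum by (simp add: wt_def flip: scaleC_add_left)
    then show "wt N i j *\<^sub>C mmul N A B i j =
       (mmul N (\<lambda>i j. wt N i j *\<^sub>C A i j) B + mmul N A (\<lambda>i j. wt N i j *\<^sub>C B i j)) i j"
      by (simp add: mmul_def scaleC_mult_left scaleC_mult_right sum.distrib)
  qed
  show "(\<lambda>i j. wt N i j *\<^sub>C lbracket (gl N) A B i j) =
    lbracket (gl N) (\<lambda>i j. wt N i j *\<^sub>C A i j) B + lbracket (gl N) A (\<lambda>i j. wt N i j *\<^sub>C B i j)"
    using mul[of A B] mul[of B A] unfolding lbracket_gl by (simp add: fun_eq_iff scaleC_diff)
  show "(\<lambda>i j. wt N i j *\<^sub>C (A + B) i j) = (\<lambda>i j. wt N i j *\<^sub>C A i j) + (\<lambda>i j. wt N i j *\<^sub>C B i j)"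
    by (simp add: fun_eq_iff scaleC_add_right)
  show "(\<lambda>i j. wt N i j *\<^sub>C mscale c A i j) = mscale c (\<lambda>i j. wt N i j *\<^sub>C A i j)"
    by (simp add: fun_eq_iff mscale_def scaleC_scaleC mult.commute)
  show "(\<lambda>i j. wt N i j *\<^sub>C A i j) \<in> lcarrier (gl N)" if "A \<in> lcarrier (gl N)"
    using that by (auto simp: in_gl_iff)
qed

text \<open>
  The weights of the factors of each product telescope. For \<open>M < N\<close> and \<open>i, j \<le> M\<close> the statement is
  about the image of an element of \<open>Ugl M\<close>, and the eigenvalue is zero.
\<close>
lemma free_derivation_t_rep:
  fixes xs :: "'a::complex_assoc_algebra list"
  assumes "M \<le> N" "i \<in> {1..N}" "j \<in> {1..N}"
  shows "free_derivation (gl_action N (mat_unit N N 1)) (t_rep M c i j xs) - const (wt N i j) * t_rep M c i j xs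
    \<in> uea_ideal (gl N)" (is "?D (t_rep M c i j xs) - _ \<in> ?J")
  using assms
proof (induction M c i j xs rule: t_rep.induct)
  case (1 M c i j)
  then show ?case by auto
next
  case (2 M c i j x)
  then have "gen (mscale (wt N i j) (mat_unit i j x)) - const (wt N i j) * eg i j x \<in> ?J"
    by (intro gl.J_gen_scale mat_unit_in_gl)
  then show ?case using 2 by (simp add: gl_action_mat_unit)
next
  case (3 M c i j x y r)
  let ?T = "\<lambda>a. t_rep M c a j (y # r)"
  let ?T' = "t_rep M c i j (x * y # r)"
  have summand: "?D (eg i a x * ?T a) - const (wt N i j) * (eg i a x * ?T a) \<in> ?J" if "a \<in> {1..M}" for a
  proof -
    have a: "a \<in> {1..N}" using that 3 by auto
    have "(gen (mscale (wt N i a) (mat_unit i a x)) - const (wt N i a) * eg i a x) * ?T a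
        + eg i a x * (?D (?T a) - const (wt N a j) * ?T a) \<in> ?J"
      using 3 a that
      by (intro gl.J_add gl.J_rmult gl.J_lmult gl.J_gen_scale mat_unit_in_gl eg_carrier t_rep_carrier 3(1)) auto
    also have "(gen (mscale (wt N i a) (mat_unit i a x)) - const (wt N i a) * eg i a x) * ?T a
        + eg i a x * (?D (?T a) - const (wt N a j) * ?T a)
      = ?D (eg i a x * ?T a) - (const (wt N i a) * (eg i a x * ?T a) + const (wt N a j) * (eg i a x * ?T a))"
      using a const_commute[of "wt N a j" "eg i a x"]
      by (simp add: free_derivation_mult gl_action_mat_unit algebra_simps) (simp flip: mult.assoc)
    also have "const (wt N i a) * (eg i a x * ?T a) + const (wt N a j) * (eg i a x * ?T a)
        = const (wt N i j) * (eg i a x * ?T a)"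
      by (simp add: wt_def flip: distrib_right const_add)
    finally show ?thesis .
  qed
  have "?D ?T' - const (wt N i j) * ?T' \<in> ?J"
    using 3 by auto
  from gl.J_lmult[OF free_carrier_const this]
  have "(\<Sum>a = 1..M. ?D (eg i a x * ?T a) - const (wt N i j) * (eg i a x * ?T a))
      + const c * (?D ?T' - const (wt N i j) * ?T') \<in> ?J"
    by (intro gl.J_add gl.J_sum summand)
  also have "(\<Sum>a = 1..M. ?D (eg i a x * ?T a) - const (wt N i j) * (eg i a x * ?T a))
      + const c * (?D ?T' - const (wt N i j) * ?T')
     = ?D (t_rep M c i j (x # y # r)) - const (wt N i j) * t_rep M c i j (x # y # r)"
    by (simp add: free_derivation_add free_derivation_sum free_derivation_const_mult sum_subtractf
        sum_distrib_left algebra_simps) (metis const_commute mult.assoc)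
  finally show ?case .
qed

section \<open>Lowering the size of the matrices modulo the one-sided ideals\<close>

text \<open>
  A set of representatives, in the free algebra, of a left ideal that contains all \<open>E\<^sub>k\<^sub>N(z)\<close>.
\<close>
locale left_ideal_rep =
  fixes N :: nat and I :: "'a::complex_assoc_algebra matrix free_algebra set"
  assumes I_add: "p \<in> I \<Longrightarrow> q \<in> I \<Longrightarrow> p + q \<in> I"
    and I_lmult: "p \<in> free_carrier (lcarrier (gl N)) \<Longrightarrow> q \<in> I \<Longrightarrow> p * q \<in> I"
    and I_J: "uea_ideal (gl N) \<subseteq> I"
    and I_gen: "k \<in> {1..N} \<Longrightarrow> eg k N z \<in> I"
begin

lemma I_zero: "0 \<in> I"
  using I_J gl.J_zero by blast

lemma I_uminus: "p \<in> I \<Longrightarrow> - p \<in> I"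
  using I_lmult[OF free_carrier_const[of "- 1"]] by (simp add: const_uminus)

lemma I_diff: "p \<in> I \<Longrightarrow> q \<in> I \<Longrightarrow> p - q \<in> I"
  using I_add[of p "- q"] I_uminus[of q] by simp

lemma I_sum: "(\<And>a. a \<in> A \<Longrightarrow> f a \<in> I) \<Longrightarrow> sum f A \<in> I"
  by (induction A rule: infinite_finite_induct) (auto intro: I_zero I_add)

text \<open>
  For \<open>j < N\<close> and modulo the left ideal, \<open>E\<^sub>k\<^sub>N(z)\<close> annihilates \<open>t\<^sub>a\<^sub>j\<close> if \<open>a < N\<close>, and takes \<open>t\<^sub>N\<^sub>j\<close>
  to \<open>t\<^sub>k\<^sub>j\<close> with \<open>z\<close> multiplied into the first letter. In the inductive step, commuting \<open>E\<^sub>k\<^sub>N(z)\<close> past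
  the first factors \<open>E\<^sub>a\<^sub>b(y)\<close> produces two further terms, in which \<open>E\<^sub>a\<^sub>N(y)\<close> and \<open>E\<^sub>a\<^sub>N(y z)\<close> are applied
  to \<open>t\<^sub>k\<^sub>j\<close> of shorter words; by the induction hypothesis both equal \<open>?G\<close>, and they cancel.
\<close>
lemma gen_t_rep:
  assumes "k \<in> {1..N}" "a \<in> {1..N}" "j \<in> {1..N}" "j \<noteq> N"
  shows "eg k N z * t_rep N c a j (y # r) - (if a = N then t_rep N c k j (z * y # r) else 0) \<in> I"
  using assms(1,2)
proof (induction "length r" arbitrary: r k a z y rule: less_induct)
  case less
  note [simp del] = One_nat_def
  show ?case
  proof (cases r)
    case Nil
    have "eg k N z * eg a j y - eg a j y * eg k N z
        - ((if a = N then eg k j (z * y) else 0) - (if k = j then eg a N (y * z) else 0)) \<in> I"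
      using less.prems assms(3) by (intro subsetD[OF I_J] eg_commutator) auto
    moreover have "eg a j y * eg k N z \<in> I"
      using less.prems assms(3) by (intro I_lmult I_gen eg_carrier)
    moreover have "(if k = j then eg a N (y * z) else 0) \<in> I"
      using less.prems by (simp add: I_gen I_zero)
    ultimately have "(eg k N z * eg a j y - eg a j y * eg k N z
        - ((if a = N then eg k j (z * y) else 0) - (if k = j then eg a N (y * z) else 0)))
        + eg a j y * eg k N z - (if k = j then eg a N (y * z) else 0) \<in> I"
      by (intro I_diff[OF I_add])
    then show ?thesis using Nil by (simp add: algebra_simps split: if_splits)
  next
    case (Cons y' r')
    let ?X = "eg k N z"
    let ?e = "\<lambda>b. eg a b y"
    let ?T = "\<lambda>b. t_rep N c b j (y' # r')"
    let ?C = "\<lambda>b. (if a = N then eg k b (z * y) else 0) - (if k = b then eg a N (y * z) else 0)"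
    let ?D = "\<lambda>b. if b = N then t_rep N c k j (z * y' # r') else 0"
    let ?G = "if k = N then t_rep N c a j (y * z * y' # r') else 0"
    let ?H = "if a = N then t_rep N c k j (z * y * y' # r') else 0"
    have IH: "eg k' N z' * t_rep N c a' j (u # r') - (if a' = N then t_rep N c k' j (z' * u # r') else 0) \<in> I"
      if "k' \<in> {1..N}" "a' \<in> {1..N}" for k' a' z' u
      using that Cons by (intro less.hyps) auto
    have 1: "(\<Sum>b = 1..N. (?X * ?e b - ?e b * ?X - ?C b) * ?T b) \<in> I"
      using less.prems assms(3)
      by (intro I_sum subsetD[OF I_J] gl.J_rmult eg_commutator t_rep_carrier) auto
    have 2: "(\<Sum>b = 1..N. ?e b * (?X * ?T b - ?D b)) \<in> I"
      using less.prems by (intro I_sum I_lmult eg_carrier IH) auto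
    have 3: "eg a N y * t_rep N c k j (z * y' # r') - ?G \<in> I"
      "eg a N (y * z) * t_rep N c k j (y' # r') - ?G \<in> I"
      using IH[of a k y "z * y'"] IH[of a k "y * z" y'] less.prems by (simp_all add: mult.assoc cong: if_cong split del: if_split)
    have 4: "const c * (?X * t_rep N c a j (y * y' # r') - ?H) \<in> I"
      using IH[of k a z "y * y'"] less.prems by (intro I_lmult) (auto simp: mult.assoc)
    have D: "(\<Sum>b = 1..N. ?e b * ?D b) = eg a N y * t_rep N c k j (z * y' # r')"
      using less.prems by (simp add: if_distrib[of "\<lambda>x. _ * x"] cong: if_cong)
    have C: "(\<Sum>b = 1..N. ?C b * ?T b) = (if a = N then \<Sum>b = 1..N. eg k b (z * y) * ?T b else 0)
        - eg a N (y * z) * t_rep N c k j (y' # r')"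
      using less.prems
      by (simp add: left_diff_distrib sum_subtractf if_distrib[of "\<lambda>x. x * _"] cong: if_cong)
    have goal_T: "t_rep N c a j (y # r) = (\<Sum>b = 1..N. ?e b * ?T b) + const c * t_rep N c a j (y * y' # r')"
      "t_rep N c k j (z * y # r) = (\<Sum>b = 1..N. eg k b (z * y) * ?T b) + const c * t_rep N c k j (z * y * y' # r')"
      using Cons by simp_all
    have "(\<Sum>b = 1..N. (?X * ?e b - ?e b * ?X - ?C b) * ?T b) + (\<Sum>b = 1..N. ?e b * (?X * ?T b - ?D b))
      = ?X * (\<Sum>b = 1..N. ?e b * ?T b) - (\<Sum>b = 1..N. ?C b * ?T b) - (\<Sum>b = 1..N. ?e b * ?D b)"
      by (simp only: left_diff_distrib right_diff_distrib sum_subtractf sum_distrib_left mult.assoc)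
        (simp add: algebra_simps)
    moreover have "?X * (const c * t_rep N c a j (y * y' # r')) = const c * (?X * t_rep N c a j (y * y' # r'))"
      by (metis const_commute mult.assoc)
    ultimately have "eg k N z * t_rep N c a j (y # r) - (if a = N then t_rep N c k j (z * y # r) else 0)
      = ((\<Sum>b = 1..N. (?X * ?e b - ?e b * ?X - ?C b) * ?T b) + (\<Sum>b = 1..N. ?e b * (?X * ?T b - ?D b)))
        + ((eg a N y * t_rep N c k j (z * y' # r') - ?G) - (eg a N (y * z) * t_rep N c k j (y' # r') - ?G))
        + const c * (?X * t_rep N c a j (y * y' # r') - ?H)"
      unfolding goal_T C D by (simp add: distrib_left right_diff_distrib)
    then show ?thesis using I_add[OF I_add[OF I_add[OF 1 2] I_diff[OF 3]] 4] by simp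
  qed
qed

text \<open>The summand \<open>a = N\<close> of the first cut is absorbed into the weight of the multiplication.\<close>
lemma t_rep_lower:
  assumes "i \<in> {1..N - 1}" "j \<in> {1..N - 1}"
  shows "t_rep N c i j xs - t_rep (N - 1) (c + 1) i j xs \<in> I"
  using assms(1)
proof (induction "length xs" arbitrary: xs i rule: less_induct)
  case less
  note [simp del] = One_nat_def
  consider "xs = []" | x where "xs = [x]" | x y r where "xs = x # y # r"
    by (metis neq_Nil_conv)
  then show ?case
  proof cases
    case 3
    have ends: "i \<in> {1..N}" "j \<in> {1..N}" "j \<noteq> N" and N: "N \<in> {1..N}" "{1..N} = insert N {1..N - 1}" "N \<notin> {1..N - 1}"
      using less.prems assms(2) by auto
    let ?d = "\<lambda>a ys. t_rep N c a j ys - t_rep (N - 1) (c + 1) a j ys"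
    have "(\<Sum>a = 1..N - 1. eg i a x * ?d a (y # r)) \<in> I"
      using less.prems 3 by (intro I_sum I_lmult eg_carrier less.hyps) auto
    moreover have "eg i N x * t_rep N c N j (y # r) - t_rep N c i j (x * y # r) \<in> I"
      using gen_t_rep[OF ends(1) N(1) ends(2,3), of x c y r] by simp
    moreover have "const (c + 1) * ?d i (x * y # r) \<in> I"
      using less.prems 3 by (intro I_lmult less.hyps) auto
    ultimately have "(\<Sum>a = 1..N - 1. eg i a x * ?d a (y # r))
        + (eg i N x * t_rep N c N j (y # r) - t_rep N c i j (x * y # r)) + const (c + 1) * ?d i (x * y # r) \<in> I"
      by (intro I_add)
    moreover have "(\<Sum>a = 1..N. eg i a x * t_rep N c a j (y # r))
        = (\<Sum>a = 1..N - 1. eg i a x * t_rep N c a j (y # r)) + eg i N x * t_rep N c N j (y # r)"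
      unfolding N(2) using N(3) by (simp add: add.commute)
    ultimately show ?thesis
      by (simp add: 3 right_diff_distrib sum_subtractf const_add distrib_right algebra_simps)
  qed (simp_all add: I_zero)
qed

end

text \<open>
  The mirrored situation: representatives of a right ideal that contains all \<open>E\<^sub>N\<^sub>k(z)\<close>. The proofs
  run as before, with the recursion at the last gap.
\<close>
locale right_ideal_rep =
  fixes N :: nat and I :: "'a::complex_assoc_algebra matrix free_algebra set"
  assumes I_add: "p \<in> I \<Longrightarrow> q \<in> I \<Longrightarrow> p + q \<in> I"
    and I_rmult: "p \<in> free_carrier (lcarrier (gl N)) \<Longrightarrow> q \<in> I \<Longrightarrow> q * p \<in> I"
    and I_J: "uea_ideal (gl N) \<subseteq> I"
    and I_gen: "k \<in> {1..N} \<Longrightarrow> eg N k z \<in> I"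
begin

lemma I_zero: "0 \<in> I"
  using I_J gl.J_zero by blast

lemma I_uminus: "p \<in> I \<Longrightarrow> - p \<in> I"
  using I_rmult[OF free_carrier_const[of "- 1"]] by (simp add: const_uminus)

lemma I_diff: "p \<in> I \<Longrightarrow> q \<in> I \<Longrightarrow> p - q \<in> I"
  using I_add[of p "- q"] I_uminus[of q] by simp

lemma I_sum: "(\<And>a. a \<in> A \<Longrightarrow> f a \<in> I) \<Longrightarrow> sum f A \<in> I"
  by (induction A rule: infinite_finite_induct) (auto intro: I_zero I_add)

lemma t_rep_gen:
  assumes "k \<in> {1..N}" "a \<in> {1..N}" "i \<in> {1..N}" "i \<noteq> N"
  shows "t_rep N c i a (r @ [y]) * eg N k z - (if a = N then t_rep N c i k (r @ [y * z]) else 0) \<in> I"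
  using assms(1,2)
proof (induction "length r" arbitrary: r k a z y rule: less_induct)
  case less
  note [simp del] = One_nat_def
  show ?case
  proof (cases r rule: rev_cases)
    case Nil
    have "eg i a y * eg N k z - eg N k z * eg i a y
        - ((if N = a then eg i k (y * z) else 0) - (if i = k then eg N a (z * y) else 0)) \<in> I"
      using less.prems assms(3) by (intro subsetD[OF I_J] eg_commutator) auto
    moreover have "eg N k z * eg i a y \<in> I"
      using less.prems assms(3) by (intro I_rmult I_gen eg_carrier)
    moreover have "(if i = k then eg N a (z * y) else 0) \<in> I"
      using less.prems by (simp add: I_gen I_zero)
    ultimately have "(eg i a y * eg N k z - eg N k z * eg i a y
        - ((if N = a then eg i k (y * z) else 0) - (if i = k then eg N a (z * y) else 0)))
        + eg N k z * eg i a y - (if i = k then eg N a (z * y) else 0) \<in> I"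
      by (intro I_diff[OF I_add])
    then show ?thesis using Nil by (simp add: algebra_simps eq_commute[of N a] split: if_splits)
  next
    case (snoc r' y')
    let ?X = "eg N k z"
    let ?e = "\<lambda>b. eg b a y"
    let ?T = "\<lambda>b. t_rep N c i b (r' @ [y'])"
    let ?C = "\<lambda>b. (if N = a then eg b k (y * z) else 0) - (if b = k then eg N a (z * y) else 0)"
    let ?D = "\<lambda>b. if b = N then t_rep N c i k (r' @ [y' * z]) else 0"
    let ?G = "if k = N then t_rep N c i a (r' @ [y' * z * y]) else 0"
    let ?H = "if a = N then t_rep N c i k (r' @ [y' * y * z]) else 0"
    have IH: "t_rep N c i a' (r' @ [u]) * eg N k' z' - (if a' = N then t_rep N c i k' (r' @ [u * z']) else 0) \<in> I"
      if "k' \<in> {1..N}" "a' \<in> {1..N}" for k' a' z' u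
      using that snoc by (intro less.hyps) auto
    have 1: "(\<Sum>b = 1..N. ?T b * (?e b * ?X - ?X * ?e b - ?C b)) \<in> I"
      using less.prems assms(3)
      by (intro I_sum subsetD[OF I_J] gl.J_lmult eg_commutator t_rep_carrier) auto
    have 2: "(\<Sum>b = 1..N. (?T b * ?X - ?D b) * ?e b) \<in> I"
      using less.prems by (intro I_sum I_rmult eg_carrier IH) auto
    have 3: "t_rep N c i k (r' @ [y' * z]) * eg N a y - ?G \<in> I"
      "t_rep N c i k (r' @ [y']) * eg N a (z * y) - ?G \<in> I"
      using IH[of a k "y' * z" y] IH[of a k y' "z * y"] less.prems by (simp_all add: mult.assoc cong: if_cong split del: if_split)
    have 4: "(t_rep N c i a (r' @ [y' * y]) * ?X - ?H) * const c \<in> I"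
      using IH[of k a "y' * y" z] less.prems by (intro I_rmult) auto
    have D: "(\<Sum>b = 1..N. ?D b * ?e b) = t_rep N c i k (r' @ [y' * z]) * eg N a y"
      using less.prems by (simp add: if_distrib[of "\<lambda>x. x * _"] cong: if_cong)
    have C: "(\<Sum>b = 1..N. ?T b * ?C b) = (if a = N then \<Sum>b = 1..N. ?T b * eg b k (y * z) else 0)
        - t_rep N c i k (r' @ [y']) * eg N a (z * y)"
      using less.prems
      by (simp add: right_diff_distrib sum_subtractf if_distrib[of "\<lambda>x. _ * x"] eq_commute[of N a] cong: if_cong)
    have goal_T: "t_rep N c i a (r @ [y]) = (\<Sum>b = 1..N. ?T b * ?e b) + const c * t_rep N c i a (r' @ [y' * y])"
      "t_rep N c i k (r @ [y * z]) = (\<Sum>b = 1..N. ?T b * eg b k (y * z)) + const c * t_rep N c i k (r' @ [y' * y * z])"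
      using t_rep_snoc[of N c i _ r' y'] snoc by (simp_all add: mult.assoc)
    have "(\<Sum>b = 1..N. ?T b * (?e b * ?X - ?X * ?e b - ?C b)) + (\<Sum>b = 1..N. (?T b * ?X - ?D b) * ?e b)
      = (\<Sum>b = 1..N. ?T b * ?e b) * ?X - (\<Sum>b = 1..N. ?T b * ?C b) - (\<Sum>b = 1..N. ?D b * ?e b)"
      by (simp only: left_diff_distrib right_diff_distrib sum_subtractf sum_distrib_right mult.assoc)
        (simp add: algebra_simps)
    then have "t_rep N c i a (r @ [y]) * eg N k z - (if a = N then t_rep N c i k (r @ [y * z]) else 0)
      = ((\<Sum>b = 1..N. ?T b * (?e b * ?X - ?X * ?e b - ?C b)) + (\<Sum>b = 1..N. (?T b * ?X - ?D b) * ?e b))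
        + ((t_rep N c i k (r' @ [y' * z]) * eg N a y - ?G) - (t_rep N c i k (r' @ [y']) * eg N a (z * y) - ?G))
        + (t_rep N c i a (r' @ [y' * y]) * ?X - ?H) * const c"
      unfolding goal_T C D const_commute[of c "_ - _", symmetric]
      by (simp add: distrib_right right_diff_distrib mult.assoc)
    then show ?thesis using I_add[OF I_add[OF I_add[OF 1 2] I_diff[OF 3]] 4] by simp
  qed
qed

lemma t_rep_lower:
  assumes "i \<in> {1..N - 1}" "j \<in> {1..N - 1}"
  shows "t_rep N c i j xs - t_rep (N - 1) (c + 1) i j xs \<in> I"
  using assms(2)
proof (induction "length xs" arbitrary: xs j rule: less_induct)
  case less
  note [simp del] = One_nat_def
  consider "xs = []" | x where "xs = [x]" | r y x where "xs = r @ [y, x]"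
    by (metis append.assoc append_Cons append_Nil rev_exhaust)
  then show ?case
  proof cases
    case 3
    have ends: "j \<in> {1..N}" "i \<in> {1..N}" "i \<noteq> N" and N: "N \<in> {1..N}" "{1..N} = insert N {1..N - 1}" "N \<notin> {1..N - 1}"
      using less.prems assms(1) by auto
    let ?d = "\<lambda>a ys. t_rep N c i a ys - t_rep (N - 1) (c + 1) i a ys"
    have "(\<Sum>a = 1..N - 1. ?d a (r @ [y]) * eg a j x) \<in> I"
      using less.prems 3 by (intro I_sum I_rmult eg_carrier less.hyps) auto
    moreover have "t_rep N c i N (r @ [y]) * eg N j x - t_rep N c i j (r @ [y * x]) \<in> I"
      using t_rep_gen[OF ends(1) N(1) ends(2,3), of c r y x] by simp
    moreover have "?d j (r @ [y * x]) * const (c + 1) \<in> I"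
      using less.prems 3 by (intro I_rmult less.hyps) auto
    ultimately have "(\<Sum>a = 1..N - 1. ?d a (r @ [y]) * eg a j x)
        + (t_rep N c i N (r @ [y]) * eg N j x - t_rep N c i j (r @ [y * x])) + const (c + 1) * ?d j (r @ [y * x]) \<in> I"
      unfolding const_commute[of "c + 1"] by (intro I_add)
    moreover have "(\<Sum>a = 1..N. t_rep N c i a (r @ [y]) * eg a j x)
        = (\<Sum>a = 1..N - 1. t_rep N c i a (r @ [y]) * eg a j x) + t_rep N c i N (r @ [y]) * eg N j x"
      unfolding N(2) using N(3) by (simp add: add.commute)
    ultimately show ?thesis
      by (simp add: 3 t_rep_snoc left_diff_distrib right_diff_distrib sum_subtractf const_add distrib_right algebra_simps)
  qed (simp_all add: I_zero)
qed

end

section \<open>The recursion computes \<open>t\<close>\<close>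

text \<open>The product of the \<open>E\<^sub>a\<^sub>b(x)\<close> along a path of indices \<open>a, b\<close>, with coefficients \<open>x\<close> from \<open>xs\<close>.\<close>
definition path_prod :: "nat list \<Rightarrow> 'a::complex_assoc_algebra list \<Rightarrow> 'a matrix free_algebra" where
  "path_prod path xs = foldr (\<lambda>k u. eg (path ! k) (path ! Suc k) (xs ! k) * u) [0..<length xs] 1"

lemma path_prod_Nil: "path_prod path [] = 1"
  by (simp add: path_prod_def)

lemma path_prod_Cons: "path_prod (i # a # path) (x # xs) = eg i a x * path_prod (a # path) xs"
  by (simp add: path_prod_def upt_conv_Cons flip: map_Suc_upt del: upt_Suc) (simp add: foldr_map comp_def)

text \<open>A representative of \<open>e_elem i j xs N\<close>.\<close>
definition e_rep :: "nat \<Rightarrow> nat \<Rightarrow> 'a::complex_assoc_algebra list \<Rightarrow> nat \<Rightarrow> 'a matrix free_algebra" where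
  "e_rep i j xs N = (\<Sum>as \<in> {as. length as = length xs - 1 \<and> set as \<subseteq> {1..N}}. path_prod (i # as @ [j]) xs)"

lemma e_rep_single: "e_rep i j [x] N = eg i j x"
proof -
  have "{as. length as = length [x] - 1 \<and> set as \<subseteq> {1..N}} = {[]}" by auto
  then show ?thesis by (simp add: e_rep_def path_prod_Cons path_prod_Nil)
qed

lemma e_rep_Cons:
  assumes "xs \<noteq> []"
  shows "e_rep i j (x # xs) N = (\<Sum>a = 1..N. eg i a x * e_rep a j xs N)"
proof -
  let ?A = "{as. length as = length xs - 1 \<and> set as \<subseteq> {1..N}}"
  have "{as. length as = length (x # xs) - 1 \<and> set as \<subseteq> {1..N}} = (\<lambda>(a, as). a # as) ` ({1..N} \<times> ?A)"
  proof -
    obtain n where n: "length xs = Suc n" using assms by (cases xs) auto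
    show ?thesis by (auto simp: n length_Suc_conv image_iff)
  qed
  moreover have "inj_on (\<lambda>(a, as). a # as) ({1..N} \<times> ?A)" by (auto simp: inj_on_def)
  ultimately have "e_rep i j (x # xs) N = (\<Sum>(a, as) \<in> {1..N} \<times> ?A. eg i a x * path_prod (a # as @ [j]) xs)"
    unfolding e_rep_def by (simp add: sum.reindex case_prod_unfold path_prod_Cons del: One_nat_def)
  also have "\<dots> = (\<Sum>a = 1..N. \<Sum>as \<in> ?A. eg i a x * path_prod (a # as @ [j]) xs)"
    by (rule sum.cartesian_product[symmetric])
  finally show ?thesis by (simp add: e_rep_def sum_distrib_left)
qed

lemma path_prod_class:
  assumes "set ks \<subseteq> {..<length xs}" "set path \<subseteq> {1..N}" "length path = Suc (length xs)"
  shows "foldr (\<lambda>k u. eg (path ! k) (path ! Suc k) (xs ! k) * u) ks 1 \<in> free_carrier (lcarrier (gl N)) \<and>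
    uea_class (gl N) (foldr (\<lambda>k u. eg (path ! k) (path ! Suc k) (xs ! k) * u) ks 1) =
    foldr (\<lambda>k u. E N (path ! k) (path ! Suc k) (xs ! k) \<otimes>\<^bsub>Ugl N\<^esub> u) ks \<one>\<^bsub>Ugl N\<^esub>"
  using assms(1)
proof (induction ks)
  case Nil
  then show ?case by (simp add: gl.class_one)
next
  case (Cons k ks)
  have "path ! k \<in> {1..N}" "path ! Suc k \<in> {1..N}"
    using Cons.prems assms(3) by (intro subsetD[OF assms(2)] nth_mem; simp)+
  then have "eg (path ! k) (path ! Suc k) (xs ! k) \<in> free_carrier (lcarrier (gl N))" by (rule eg_carrier)
  with Cons show ?case by (simp add: gl.class_mult E_def uea_gen_def free_carrier_mult)
qed

lemma e_elem_eq:
  fixes xs :: "'a::complex_assoc_algebra list"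
  assumes "i \<in> {1..N}" "j \<in> {1..N}" "xs \<noteq> []"
  shows "e_rep i j xs N \<in> free_carrier (lcarrier (gl N))"
    and "e_elem i j xs N = uea_class (gl N) (e_rep i j xs N)"
proof -
  let ?A = "{as. length as = length xs - 1 \<and> set as \<subseteq> {1..N}}"
  have fin: "finite ?A"
    using finite_lists_length_eq[of "{1..N}" "length xs - 1"] by (simp add: conj_commute)
  have path: "path_prod (i # as @ [j]) xs \<in> free_carrier (lcarrier (gl N)) \<and>
     uea_class (gl N) (path_prod (i # as @ [j]) xs) =
     foldr (\<lambda>k u. E N ((i # as @ [j]) ! k) ((i # as @ [j]) ! Suc k) (xs ! k) \<otimes>\<^bsub>Ugl N\<^esub> u) [0..<length xs] \<one>\<^bsub>Ugl N\<^esub>"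
    if "as \<in> ?A" for as
    unfolding path_prod_def using assms that by (intro path_prod_class) auto
  show car: "e_rep i j xs N \<in> free_carrier (lcarrier (gl N))"
    unfolding e_rep_def using path by (intro free_carrier_sum) blast
  interpret U: Ring.ring "Ugl N :: 'a matrix free_algebra set ring" by (rule ring_Ugl)
  have "uea_class (gl N) (e_rep i j xs N) = (\<Oplus>\<^bsub>Ugl N\<^esub> as \<in> ?A. uea_class (gl N) (path_prod (i # as @ [j]) xs))"
    unfolding e_rep_def using path fin by (intro gl.class_finsum) auto
  also have "\<dots> = e_elem i j xs N"
    unfolding e_elem_def Let_def
  proof (rule U.finsum_cong')
    let ?g = "\<lambda>as. foldr (\<lambda>k u. E N ((i # as @ [j]) ! k) ((i # as @ [j]) ! Suc k) (xs ! k) \<otimes>\<^bsub>Ugl N\<^esub> u)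
        [0..<length xs] \<one>\<^bsub>Ugl N\<^esub>"
    show "uea_class (gl N) (path_prod (i # as @ [j]) xs) = ?g as" if "as \<in> ?A" for as
      using path[OF that] by (rule conjunct2)
    show "?g \<in> ?A \<rightarrow> carrier (Ugl N)"
    proof
      fix as assume "as \<in> ?A"
      from path[OF this] show "?g as \<in> carrier (Ugl N)"
        by (elim conjE) (erule subst, rule gl.class_closed)
    qed
  qed (rule refl)
  finally show "e_elem i j xs N = uea_class (gl N) (e_rep i j xs N)" by simp
qed

lemma length_merge [simp]: "length (xs \<rhd> \<nu>) = length \<nu>"
  by (induction \<nu> arbitrary: xs) auto

lemma composition_length: "\<nu> \<in> compositions m \<Longrightarrow> length \<nu> \<le> m"
  unfolding compositions_def
proof (induction \<nu> arbitrary: m)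
  case (Cons n \<nu>)
  then have "length \<nu> \<le> m - n" "n \<ge> 1" "m \<ge> n" by auto
  then show ?case by simp
qed simp

lemma composition_not_Nil: "\<nu> \<in> compositions m \<Longrightarrow> m > 0 \<Longrightarrow> \<nu> \<noteq> []"
  by (auto simp: compositions_def)

lemma compositions_1: "compositions (Suc 0) = {[1]}"
proof -
  have "\<nu> = [1]" if "\<nu> \<in> compositions (Suc 0)" for \<nu>
    using that by (cases \<nu>; cases "tl \<nu>") (auto simp: compositions_def)
  then show ?thesis by (auto simp: compositions_def)
qed

text \<open>
  A composition of \<open>m + 1\<close> has first part \<open>1\<close>, or arises from one of \<open>m\<close> by enlarging the first part.
  This distinction is the choice made at the first gap.
\<close>
lemma compositions_Suc:
  assumes "m > 0"
  shows "compositions (Suc m) = (#) 1 ` compositions m \<union> (\<lambda>\<nu>. Suc (hd \<nu>) # tl \<nu>) ` compositions m"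
proof (intro equalityI subsetI)
  fix \<nu> assume \<nu>: "\<nu> \<in> compositions (Suc m)"
  then obtain n \<mu> where n: "\<nu> = n # \<mu>" using composition_not_Nil by (metis list.exhaust zero_less_Suc)
  show "\<nu> \<in> (#) 1 ` compositions m \<union> (\<lambda>\<nu>. Suc (hd \<nu>) # tl \<nu>) ` compositions m"
  proof (cases "n = 1")
    case True
    then show ?thesis using \<nu> n by (auto simp: compositions_def)
  next
    case False
    then have "(n - 1) # \<mu> \<in> compositions m" "\<nu> = Suc (hd ((n - 1) # \<mu>)) # tl ((n - 1) # \<mu>)"
      using \<nu> n by (auto simp: compositions_def)
    then show ?thesis by blast
  qed
next
  fix \<nu> assume "\<nu> \<in> (#) 1 ` compositions m \<union> (\<lambda>\<nu>. Suc (hd \<nu>) # tl \<nu>) ` compositions m"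
  then obtain \<mu> where \<mu>: "\<mu> \<in> compositions m" "\<nu> = 1 # \<mu> \<or> \<nu> = Suc (hd \<mu>) # tl \<mu>" by blast
  then obtain n \<mu>' where "\<mu> = n # \<mu>'" using composition_not_Nil[OF _ assms] by (metis list.exhaust)
  then show "\<nu> \<in> compositions (Suc m)" using \<mu> by (auto simp: compositions_def)
qed

lemma finite_compositions: "finite (compositions m)"
proof (induction m)
  case 0
  have "\<nu> = []" if "\<nu> \<in> compositions 0" for \<nu>
    using composition_length[OF that] by simp
  then have "compositions 0 \<subseteq> {[]}" by blast
  then show ?case by (rule finite_subset) simp
next
  case (Suc m)
  then show ?case by (cases "m = 0") (auto simp: compositions_1 compositions_Suc)
qed

lemma merge_cut: "(x # xs) \<rhd> (1 # \<nu>) = x # (xs \<rhd> \<nu>)"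
  by simp

lemma block_prod_mult: "block_prod (x # y # zs) = block_prod ((x * y) # zs)"
  by (cases zs) (simp_all add: mult.assoc)

lemma merge_mult:
  assumes "\<nu> \<noteq> []" "hd \<nu> \<ge> 1"
  shows "(x # y # r) \<rhd> (Suc (hd \<nu>) # tl \<nu>) = (x * y # r) \<rhd> \<nu>"
proof -
  obtain k \<mu> where "\<nu> = Suc k # \<mu>"
    using assms by (metis Suc_pred' list.exhaust_sel less_eq_Suc_le One_nat_def)
  then show ?thesis by (simp add: block_prod_mult del: block_prod.simps)
qed

lemma t_rep_eq:
  assumes "xs \<noteq> []"
  shows "t_rep N c i j xs =
    (\<Sum>\<nu> \<in> compositions (length xs). const (c ^ (length xs - length \<nu>)) * e_rep i j (xs \<rhd> \<nu>) N)"
  using assms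
proof (induction N c i j xs rule: t_rep.induct)
  case (2 N c i j x)
  then show ?case by (simp add: compositions_1 e_rep_single)
next
  case (3 N c i j x y r)
  let ?m = "Suc (length r)"
  let ?inc = "\<lambda>\<nu>. Suc (hd \<nu>) # tl \<nu>"
  let ?f = "\<lambda>\<nu>. const (c ^ (Suc ?m - length \<nu>)) * e_rep i j ((x # y # r) \<rhd> \<nu>) N"
  let ?C = "compositions ?m"
  have ne: "\<nu> \<noteq> []" and hd: "hd \<nu> \<ge> 1" and len: "length \<nu> \<le> ?m" if "\<nu> \<in> ?C" for \<nu>
    using that composition_not_Nil[OF that] composition_length[OF that] by (auto simp: compositions_def)
  have "(\<Sum>\<nu> \<in> compositions (Suc ?m). ?f \<nu>) = (\<Sum>\<nu> \<in> (#) 1 ` ?C. ?f \<nu>) + (\<Sum>\<nu> \<in> ?inc ` ?C. ?f \<nu>)"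
  proof -
    have "(#) 1 ` ?C \<inter> ?inc ` ?C = {}"
      using hd by fastforce
    then show ?thesis
      by (simp add: compositions_Suc sum.union_disjoint finite_compositions)
  qed
  moreover have "(\<Sum>\<nu> \<in> (#) 1 ` ?C. ?f \<nu>) = (\<Sum>a = 1..N. eg i a x * t_rep N c a j (y # r))"
  proof -
    have "(\<Sum>\<nu> \<in> (#) 1 ` ?C. ?f \<nu>) = (\<Sum>\<nu> \<in> ?C. ?f (1 # \<nu>))"
      by (simp add: sum.reindex)
    also have "\<dots> = (\<Sum>\<nu> \<in> ?C. \<Sum>a = 1..N. eg i a x * (const (c ^ (?m - length \<nu>)) * e_rep a j ((y # r) \<rhd> \<nu>) N))"
    proof (intro sum.cong refl)
      fix \<nu> assume "\<nu> \<in> ?C"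
      then have "(y # r) \<rhd> \<nu> \<noteq> []" using ne length_merge by (metis length_0_conv)
      then have "?f (1 # \<nu>) = const (c ^ (?m - length \<nu>)) * (\<Sum>a = 1..N. eg i a x * e_rep a j ((y # r) \<rhd> \<nu>) N)"
        unfolding merge_cut by (simp add: e_rep_Cons)
      then show "?f (1 # \<nu>) = (\<Sum>a = 1..N. eg i a x * (const (c ^ (?m - length \<nu>)) * e_rep a j ((y # r) \<rhd> \<nu>) N))"
        by (simp add: sum_distrib_left) (metis (no_types, lifting) const_commute mult.assoc)
    qed
    also have "\<dots> = (\<Sum>a = 1..N. \<Sum>\<nu> \<in> ?C. eg i a x * (const (c ^ (?m - length \<nu>)) * e_rep a j ((y # r) \<rhd> \<nu>) N))"
      by (rule sum.swap)
    also have "\<dots> = (\<Sum>a = 1..N. eg i a x * t_rep N c a j (y # r))"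
      using 3(1) by (intro sum.cong) (simp_all add: sum_distrib_left)
    finally show ?thesis .
  qed
  moreover have "(\<Sum>\<nu> \<in> ?inc ` ?C. ?f \<nu>) = const c * t_rep N c i j (x * y # r)"
  proof -
    have "inj_on ?inc ?C"
      using ne by (intro inj_onI) (metis Suc_inject list.expand list.inject)
    then have "(\<Sum>\<nu> \<in> ?inc ` ?C. ?f \<nu>) = (\<Sum>\<nu> \<in> ?C. ?f (?inc \<nu>))"
      by (simp add: sum.reindex)
    also have "\<dots> = (\<Sum>\<nu> \<in> ?C. const c * (const (c ^ (?m - length \<nu>)) * e_rep i j ((x * y # r) \<rhd> \<nu>) N))"
    proof (intro sum.cong refl)
      fix \<nu> assume \<nu>: "\<nu> \<in> ?C"
      have "length (?inc \<nu>) = length \<nu>" using ne[OF \<nu>] by (cases \<nu>) auto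
      then have "c ^ (Suc ?m - length (?inc \<nu>)) = c * c ^ (?m - length \<nu>)"
        using len[OF \<nu>] by (simp add: Suc_diff_le)
      then show "?f (?inc \<nu>) = const c * (const (c ^ (?m - length \<nu>)) * e_rep i j ((x * y # r) \<rhd> \<nu>) N)"
        unfolding merge_mult[OF ne[OF \<nu>] hd[OF \<nu>]] by (simp add: const_mult mult.assoc)
    qed
    finally show ?thesis using 3(2) by (simp add: sum_distrib_left)
  qed
  ultimately show ?case by simp
qed simp

lemma t_elem_eq:
  fixes xs :: "'a::complex_assoc_algebra list"
  assumes "i \<in> {1..N}" "j \<in> {1..N}" "xs \<noteq> []"
  shows "t_elem i j xs N s = uea_class (gl N) (t_rep N (- of_nat N - s) i j xs)"
proof -
  let ?c = "- of_nat N - s"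
  interpret U: Ring.ring "Ugl N :: 'a matrix free_algebra set ring" by (rule ring_Ugl)
  let ?g = "\<lambda>\<nu>. const (?c ^ (length xs - length \<nu>)) * e_rep i j (xs \<rhd> \<nu>) N"
  have *: "e_rep i j (xs \<rhd> \<nu>) N \<in> free_carrier (lcarrier (gl N))"
    "e_elem i j (xs \<rhd> \<nu>) N = uea_class (gl N) (e_rep i j (xs \<rhd> \<nu>) N)"
    if "\<nu> \<in> compositions (length xs)" for \<nu>
  proof -
    have "xs \<rhd> \<nu> \<noteq> []"
      using composition_not_Nil[OF that] assms(3) length_merge by (metis length_0_conv length_greater_0_conv)
    then show "e_rep i j (xs \<rhd> \<nu>) N \<in> free_carrier (lcarrier (gl N))"
      "e_elem i j (xs \<rhd> \<nu>) N = uea_class (gl N) (e_rep i j (xs \<rhd> \<nu>) N)"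
      using e_elem_eq assms by blast+
  qed
  have "uea_class (gl N) (t_rep N ?c i j xs) = (\<Oplus>\<^bsub>Ugl N\<^esub> \<nu> \<in> compositions (length xs). uea_class (gl N) (?g \<nu>))"
    unfolding t_rep_eq[OF assms(3)] using * by (intro gl.class_finsum finite_compositions) auto
  also have "\<dots> = t_elem i j xs N s"
    unfolding t_elem_def
  proof (intro U.finsum_cong')
    show "(\<lambda>\<nu>. uea_const (gl N) (?c ^ (length xs - length (xs \<rhd> \<nu>))) \<otimes>\<^bsub>Ugl N\<^esub> e_elem i j (xs \<rhd> \<nu>) N)
        \<in> compositions (length xs) \<rightarrow> carrier (Ugl N)"
      using * by (auto simp: uea_const_def intro!: gl.class_closed U.m_closed)
    show "uea_class (gl N) (?g \<nu>) =
        uea_const (gl N) (?c ^ (length xs - length (xs \<rhd> \<nu>))) \<otimes>\<^bsub>Ugl N\<^esub> e_elem i j (xs \<rhd> \<nu>) N"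
      if "\<nu> \<in> compositions (length xs)" for \<nu>
      using *[OF that] by (simp add: uea_const_def gl.class_mult)
  qed simp
  finally show ?thesis by simp
qed

section \<open>The projection\<close>

lemma left_ideal_gen_closed:
  "a \<in> left_ideal_gen R G \<Longrightarrow> b \<in> left_ideal_gen R G \<Longrightarrow> a \<oplus>\<^bsub>R\<^esub> b \<in> left_ideal_gen R G"
  "r \<in> carrier R \<Longrightarrow> a \<in> left_ideal_gen R G \<Longrightarrow> r \<otimes>\<^bsub>R\<^esub> a \<in> left_ideal_gen R G"
  "\<zero>\<^bsub>R\<^esub> \<in> left_ideal_gen R G"
  "g \<in> G \<Longrightarrow> g \<in> left_ideal_gen R G"
  unfolding left_ideal_gen_def by (auto intro: additive_subgroup.a_closed additive_subgroup.zero_closed)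

lemma right_ideal_gen_closed:
  "a \<in> right_ideal_gen R G \<Longrightarrow> b \<in> right_ideal_gen R G \<Longrightarrow> a \<oplus>\<^bsub>R\<^esub> b \<in> right_ideal_gen R G"
  "r \<in> carrier R \<Longrightarrow> a \<in> right_ideal_gen R G \<Longrightarrow> a \<otimes>\<^bsub>R\<^esub> r \<in> right_ideal_gen R G"
  "\<zero>\<^bsub>R\<^esub> \<in> right_ideal_gen R G"
  "g \<in> G \<Longrightarrow> g \<in> right_ideal_gen R G"
  unfolding right_ideal_gen_def by (auto intro: additive_subgroup.a_closed additive_subgroup.zero_closed)

lemma class_J: "p \<in> uea_ideal (gl N) \<Longrightarrow> uea_class (gl N) p = \<zero>\<^bsub>Ugl N\<^esub>"
  by (metis gl.class_eq_iff gl.class_zero diff_zero)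

lemma left_ideal_rep_I_plus:
  "left_ideal_rep N {p \<in> free_carrier (lcarrier (gl N)). uea_class (gl N) p \<in> I_plus N}"
proof unfold_locales
  fix k z assume "k \<in> {1..N}"
  then have "uea_class (gl N) (eg k N z) \<in> I_plus N"
    unfolding I_plus_def by (intro left_ideal_gen_closed(4)) (auto simp: E_def uea_gen_def)
  moreover have "eg k N z \<in> free_carrier (lcarrier (gl N))"
    using \<open>k \<in> {1..N}\<close> by (intro eg_carrier) auto
  ultimately show "eg k N z \<in> {p \<in> free_carrier (lcarrier (gl N)). uea_class (gl N) p \<in> I_plus N}"
    by simp
next
  show "uea_ideal (gl N) \<subseteq> {p \<in> free_carrier (lcarrier (gl N)). uea_class (gl N) p \<in> I_plus N}"
    using gl.J_carrier by (auto simp: class_J I_plus_def left_ideal_gen_closed)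
qed (auto simp: gl.class_add gl.class_mult I_plus_def left_ideal_gen_closed gl.class_closed)

lemma right_ideal_rep_I_minus:
  "right_ideal_rep N {p \<in> free_carrier (lcarrier (gl N)). uea_class (gl N) p \<in> I_minus N}"
proof unfold_locales
  fix k z assume "k \<in> {1..N}"
  then have "uea_class (gl N) (eg N k z) \<in> I_minus N"
    unfolding I_minus_def by (intro right_ideal_gen_closed(4)) (auto simp: E_def uea_gen_def)
  moreover have "eg N k z \<in> free_carrier (lcarrier (gl N))"
    using \<open>k \<in> {1..N}\<close> by (intro eg_carrier) auto
  ultimately show "eg N k z \<in> {p \<in> free_carrier (lcarrier (gl N)). uea_class (gl N) p \<in> I_minus N}"
    by simp
next
  show "uea_ideal (gl N) \<subseteq> {p \<in> free_carrier (lcarrier (gl N)). uea_class (gl N) p \<in> I_minus N}"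
    using gl.J_carrier by (auto simp: class_J I_minus_def right_ideal_gen_closed)
qed (auto simp: gl.class_add gl.class_mult I_minus_def right_ideal_gen_closed gl.class_closed)

lemma class_invariant:
  assumes "N \<ge> 1" "p \<in> free_carrier (lcarrier (gl N))"
    and "free_derivation (gl_action N (mat_unit N N 1)) p \<in> uea_ideal (gl N)"
  shows "uea_class (gl N) p \<in> invariants N"
  using assms by (simp add: invariants_def gl.class_closed gl.uea_derivation_class[OF J_gl_action] class_J)

lemma gl_embedding_class: "gl_embedding N (uea_class (gl (N - 1)) p) = uea_class (gl N) p"
proof -
  have "uea_class (gl N) q = uea_class (gl N) p" if "q \<in> uea_class (gl (N - 1)) p" for q
    using that uea_ideal_gl_mono[of "N - 1" N] unfolding gl.class_eq_iff by (auto simp: gl.class_eq)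
  moreover have "p \<in> uea_class (gl (N - 1)) p" by (simp add: gl.class_eq)
  ultimately show ?thesis unfolding gl_embedding_def uea_embedding_def by blast
qed

text \<open>
  It suffices to exhibit one component in the smaller enveloping algebra: two of them differ by an
  element that \<open>gl_subalgebra_Int_I_plus\<close> shows to be zero.
\<close>
lemma projection_eqI:
  fixes p q :: "'a::complex_assoc_algebra matrix free_algebra"
  assumes p: "p \<in> free_carrier (lcarrier (gl N))" "uea_class (gl N) p \<in> invariants N"
    and q: "q \<in> free_carrier (lcarrier (gl (N - 1)))" and L: "uea_class (gl N) (p - q) \<in> L_ideal N"
  shows "projection N (uea_class (gl N) p) = uea_class (gl (N - 1)) q"
proof -
  interpret left_ideal_rep N "{p :: 'a matrix free_algebra. p \<in> free_carrier (lcarrier (gl N)) \<and> uea_class (gl N) p \<in> I_plus N}"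
    by (rule left_ideal_rep_I_plus)
  have sub: "free_carrier (lcarrier (gl (N - 1))) \<subseteq> free_carrier (lcarrier (gl N :: 'a matrix lie_algebra))"
    by (intro free_carrier_mono gl_mono) simp
  have diff: "uea_class (gl N) p \<ominus>\<^bsub>Ugl N\<^esub> gl_embedding N (uea_class (gl (N - 1)) r) = uea_class (gl N) (p - r)"
    if "r \<in> free_carrier (lcarrier (gl (N - 1)))" for r
    unfolding gl_embedding_class using p(1) that sub by (intro gl.class_diff) auto
  have "(THE v. v \<in> carrier (Ugl (N - 1)) \<and> uea_class (gl N) p \<ominus>\<^bsub>Ugl N\<^esub> gl_embedding N v \<in> L_ideal N)
      = uea_class (gl (N - 1)) q"
  proof (rule the_equality)
    show "uea_class (gl (N - 1)) q \<in> carrier (Ugl (N - 1)) \<and>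
        uea_class (gl N) p \<ominus>\<^bsub>Ugl N\<^esub> gl_embedding N (uea_class (gl (N - 1)) q) \<in> L_ideal N"
      unfolding diff[OF q] using q L gl.class_closed by blast
    fix v assume v: "v \<in> carrier (Ugl (N - 1)) \<and> uea_class (gl N) p \<ominus>\<^bsub>Ugl N\<^esub> gl_embedding N v \<in> L_ideal N"
    then obtain r where r: "r \<in> free_carrier (lcarrier (gl (N - 1)))" "v = uea_class (gl (N - 1)) r"
      unfolding gl.carrier_uea by blast
    have "uea_class (gl N) (p - r) \<in> L_ideal N"
      using v unfolding r(2) diff[OF r(1)] by blast
    then have "uea_class (gl N) (p - q) \<in> I_plus N" "uea_class (gl N) (p - r) \<in> I_plus N"
      using L by (simp_all add: L_ideal_def)
    moreover have "p - q \<in> free_carrier (lcarrier (gl N))" "p - r \<in> free_carrier (lcarrier (gl N))"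
      using p(1) q r(1) sub by auto
    ultimately have "uea_class (gl N) ((p - q) - (p - r)) \<in> I_plus N"
      using I_diff[of "p - q" "p - r"] by blast
    then have "r - q \<in> uea_ideal (gl (N - 1))"
      using q r(1) by (intro gl_subalgebra_Int_I_plus) auto
    then show "v = uea_class (gl (N - 1)) q" by (simp add: r gl.class_eq_iff)
  qed
  then show ?thesis using p(2) by (simp add: projection_def)
qed

theorem theorem3p4:
  fixes x :: "'a::complex_assoc_algebra list" and s :: complex and i j N :: nat
  assumes "countable_dimension TYPE('a)"
    and "x \<noteq> []"
    and "i \<ge> 1" and "j \<ge> 1"
    and "N > max i j"
  shows "projection N (t_elem i j x N s) = t_elem i j x (N - 1) s"
proof -
  let ?c = "- of_nat N - s"
  let ?T = "t_rep N ?c i j x" and ?T' = "t_rep (N - 1) (?c + 1) i j x"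
  have small: "i \<in> {1..N - 1}" "j \<in> {1..N - 1}" and big: "i \<in> {1..N}" "j \<in> {1..N}"
    using assms(3-5) by auto
  have "N \<ge> 1" using assms(5) by simp
  have "- of_nat (N - 1) - s = ?c + 1" using \<open>N \<ge> 1\<close> by (simp add: of_nat_diff)
  then have t: "t_elem i j x N s = uea_class (gl N) ?T"
    "t_elem i j x (N - 1) s = uea_class (gl (N - 1)) ?T'"
    using t_elem_eq[OF big assms(2)] t_elem_eq[OF small assms(2), of s] by metis+
  have "wt N i j = 0" using assms(5) by (auto simp: wt_def)
  then have D: "free_derivation (gl_action N (mat_unit N N 1)) ?T \<in> uea_ideal (gl N)"
    "free_derivation (gl_action N (mat_unit N N 1)) ?T' \<in> uea_ideal (gl N)"
    using free_derivation_t_rep[OF order_refl big, of ?c x]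
      free_derivation_t_rep[OF diff_le_self big, of 1 "?c + 1" x] by simp_all
  have carrier: "?T \<in> free_carrier (lcarrier (gl N))" "?T' \<in> free_carrier (lcarrier (gl N))"
    "?T' \<in> free_carrier (lcarrier (gl (N - 1)))"
    using big small by (auto intro!: t_rep_carrier)
  have "uea_class (gl N) (?T - ?T') \<in> invariants N"
    using \<open>N \<ge> 1\<close> carrier D by (intro class_invariant) (auto simp: free_derivation_diff)
  moreover have "uea_class (gl N) (?T - ?T') \<in> I_plus N" "uea_class (gl N) (?T - ?T') \<in> I_minus N"
    using left_ideal_rep.t_rep_lower[OF left_ideal_rep_I_plus small]
      right_ideal_rep.t_rep_lower[OF right_ideal_rep_I_minus small] by blast+
  ultimately have "uea_class (gl N) (?T - ?T') \<in> L_ideal N" by (simp add: L_ideal_def)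
  moreover have "uea_class (gl N) ?T \<in> invariants N"
    using \<open>N \<ge> 1\<close> carrier D by (intro class_invariant)
  ultimately show ?thesis unfolding t using carrier by (intro projection_eqI)
qed

end
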